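(* Let $T$ be a tree of order $n\ge4$ which is not isomorphic to the star $K_{1,n-1}$. Then $\xi_n(T^c)\le\xi_n(P_n^c)$, with equality if and only if $T\cong P_n$.
   Context: For a connected graph $G$ on $n$ vertices, the eccentricity matrix $\mathcal{E}(G)$ is the matrix indexed by $V(G)$ whose $(u,v)$-entry is $d_G(u,v)$ if $d_G(u,v)=\min\{e_G(u),e_G(v)\}$ and $0$ otherwise, where $d_G$ is the graph distance and $e_G(u)=\max_v d_G(u,v)$. $\xi_n(G)$ denotes the least eigenvalue of $\mathcal{E}(G)$. $T^c$ is the complement of $T$ and $P_n$ is the path on $n$ vertices. *)

theory Defs
  imports
    "Graph_Theory.Shortest_Path"
    "Graph_Theory.Digraph_Isomorphism"
    "Graph_Theory.Kuratowski"
    "Jordan_Normal_Form.Spectral_Radius"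
begin

text \<open>
  A finite simple undirected graph is a \<^locale>\<open>pair_graph\<close>: each edge is represented by its two
  opposite arcs. A single edge traversed back and forth is therefore a library cycle of
  length 2, so the library's \<^const>\<open>Digraph_Component.tree\<close> does not describe undirected trees;
  the cycles of the undirected graph are the library cycles of length at least 3.
\<close>

definition undirected_tree :: "'a pair_pre_digraph \<Rightarrow> bool" where
  "undirected_tree G \<longleftrightarrow> pair_graph G \<and> Digraph_Component.connected (with_proj G) \<and>
     \<not> (\<exists>p. pre_digraph.cycle (with_proj G) p \<and> 3 \<le> length p)"

definition complement_graph :: "'a pair_pre_digraph \<Rightarrow> 'a pair_pre_digraph" where
  "complement_graph G = \<lparr> pverts = pverts G,
     parcs = {(u, v). u \<in> pverts G \<and> v \<in> pverts G \<and> u \<noteq> v \<and> (u, v) \<notin> parcs G} \<rparr>"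

definition path_graph :: "nat \<Rightarrow> nat pair_pre_digraph" where
  "path_graph n = \<lparr> pverts = {0..<n},
     parcs = {(i, j). i < n \<and> j < n \<and> (j = Suc i \<or> i = Suc j)} \<rparr>"

text \<open>
  The distance is the shortest-path cost for unit arc weights. The conversion to \<^typ>\<open>real\<close>
  sends the infinite distance of disconnected vertices to 0, so \<open>graph_dist\<close> and the notions
  built on it are meaningful only for connected graphs.
\<close>

definition graph_dist :: "'a pair_pre_digraph \<Rightarrow> 'a \<Rightarrow> 'a \<Rightarrow> real" where
  "graph_dist G u v = real_of_ereal (wf_digraph.\<mu> (with_proj G) (\<lambda>_. 1) u v)"

definition eccentricity :: "'a pair_pre_digraph \<Rightarrow> 'a \<Rightarrow> real" where
  "eccentricity G u = Max (graph_dist G u ` pverts G)"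

definition ecc_entry :: "'a pair_pre_digraph \<Rightarrow> 'a \<Rightarrow> 'a \<Rightarrow> real" where
  "ecc_entry G u v =
     (if graph_dist G u v = min (eccentricity G u) (eccentricity G v) then graph_dist G u v else 0)"

text \<open>
  Library matrices have rows and columns numbered from 0, so the matrix indexed by the vertices
  is written along an enumeration of them. Two enumerations give matrices that differ by a
  simultaneous permutation of rows and columns, hence with the same spectrum.
\<close>

definition ecc_matrix :: "'a pair_pre_digraph \<Rightarrow> real mat" where
  "ecc_matrix G =
     (let n = card (pverts G); f = (SOME f. bij_betw f {0..<n} (pverts G))
      in mat n n (\<lambda>(i, j). ecc_entry G (f i) (f j)))"

text \<open>
  The matrix is real symmetric for an undirected graph, so its real spectrum is its whole spectrum.
\<close>

definition least_ecc_eigenvalue :: "'a pair_pre_digraph \<Rightarrow> real" where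
  "least_ecc_eigenvalue G = Min (spectrum (ecc_matrix G))"

end

(*
  In the complement of a tree T that is not a star, two distinct vertices are at distance 1
  unless they are adjacent in T; adjacent ones are at distance 2, or 3 if together they dominate T.
  Hence the eccentricity matrix of T^c is supported on the edges of T with entries 2 (or a single
  3 for the central edge of a double star), and since T is bipartite its least eigenvalue is at most
  -2 lambda(T), where lambda is the largest adjacency eigenvalue, with equality for paths on at
  least 5 vertices. It remains to see that lambda(T) > lambda(P_n) = 2 cos theta,
  theta = pi/(n+1), whenever T has no Hamiltonian path.

  Put g(m) = sin((m+1) theta)/sin(m theta). By induction on the construction of rooted trees, a
  rooted tree with m vertices has a nonnegative vector x equal to 1 at the root with
  2 cos theta |x|^2 - x.Ax <= g(m). Joining a second tree of size k below the root with scaling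
  factor 1/g(k) gives the bound g(m) - 1/g(k), which is at most g(m+k) because
  sin a sin b - sin theta sin(a + b - theta) = sin(a - theta) sin(b - theta). For m = n the bound
  is g(n) = 0, and it is strict unless all joins build a path.
*)
theory Submission
  imports Defs "HOL-Analysis.Function_Topology"
begin

section \<open>Eigenvalues of quadratic forms on a finite set\<close>

definition quad_form :: "'a set \<Rightarrow> ('a \<Rightarrow> 'a \<Rightarrow> real) \<Rightarrow> ('a \<Rightarrow> real) \<Rightarrow> real" where
  "quad_form V b x = (\<Sum>u\<in>V. \<Sum>v\<in>V. b u v * x u * x v)"

text \<open>Matrices are kept as functions on the vertex set, so that no enumeration of vertices
  enters the estimates. Values off \<open>V\<close> are irrelevant, hence the vector has to be
  nonzero on \<open>V\<close> itself.\<close>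

definition eigenvalue_on :: "'a set \<Rightarrow> ('a \<Rightarrow> 'a \<Rightarrow> real) \<Rightarrow> real \<Rightarrow> bool" where
  "eigenvalue_on V b k \<longleftrightarrow>
     (\<exists>x. (\<exists>u\<in>V. x u \<noteq> 0) \<and> (\<forall>u\<in>V. (\<Sum>v\<in>V. b u v * x v) = k * x u))"

lemma quad_form_add:
  assumes "\<And>u v. u \<in> V \<Longrightarrow> v \<in> V \<Longrightarrow> b u v = b v u"
  shows "quad_form V b (\<lambda>u. x u + s * y u) =
    quad_form V b x + 2 * s * (\<Sum>u\<in>V. \<Sum>v\<in>V. b u v * y u * x v) + s\<^sup>2 * quad_form V b y"
proof -
  have sw: "(\<Sum>u\<in>V. \<Sum>v\<in>V. b u v * y v * x u) = (\<Sum>u\<in>V. \<Sum>v\<in>V. b u v * y u * x v)"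
    by (subst sum.swap) (auto intro!: sum.cong simp: assms)
  have "quad_form V b (\<lambda>u. x u + s * y u) = quad_form V b x +
      s * (\<Sum>u\<in>V. \<Sum>v\<in>V. b u v * y v * x u) + s * (\<Sum>u\<in>V. \<Sum>v\<in>V. b u v * y u * x v)
      + s\<^sup>2 * quad_form V b y"
    unfolding quad_form_def sum_distrib_left sum.distrib[symmetric]
    by (intro sum.cong refl) (simp add: algebra_simps power2_eq_square)
  then show ?thesis unfolding sw by simp
qed

text \<open>The function type carries the product topology, in which Tychonoff's theorem makes a box
  of intervals compact; the unit sphere is a closed part of the box. Forcing zeros off
  \<open>V\<close> keeps the remaining factors compact.\<close>

lemma compact_unit_vectors:
  "compact {x :: 'a \<Rightarrow> real. (\<forall>i. i \<notin> V \<longrightarrow> x i = 0) \<and> (\<Sum>u\<in>V. (x u)\<^sup>2) = 1}" (is "compact ?S")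
  if "finite V"
proof -
  define B :: "'a \<Rightarrow> real set" where "B i = (if i \<in> V then {-1..1} else {0})" for i
  have "compactin (product_topology (\<lambda>_. euclidean) UNIV) (PiE UNIV B)"
    by (auto simp: compactin_PiE B_def)
  then have box: "compact (PiE UNIV B)"
    by (simp add: euclidean_product_topology)
  have "closed {x :: 'a \<Rightarrow> real. (\<Sum>u\<in>V. (x u)\<^sup>2) = 1}"
    by (intro closed_Collect_eq continuous_on_sum continuous_on_power continuous_on_const
        continuous_on_product_coordinates)
  then have "compact (PiE UNIV B \<inter> {x. (\<Sum>u\<in>V. (x u)\<^sup>2) = 1})"
    by (rule compact_Int_closed[OF box])
  also have "PiE UNIV B \<inter> {x. (\<Sum>u\<in>V. (x u)\<^sup>2) = 1} = ?S"
  proof -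
    have "\<bar>x i\<bar> \<le> 1" if "i \<in> V" "(\<Sum>u\<in>V. (x u)\<^sup>2) = 1" for x :: "'a \<Rightarrow> real" and i
    proof -
      have "(x i)\<^sup>2 \<le> 1"
        using member_le_sum[OF that(1), of "\<lambda>u. (x u)\<^sup>2"] that \<open>finite V\<close> by simp
      then show ?thesis by (simp add: abs_square_le_1)
    qed
    then have box_mem: "x \<in> PiE UNIV B" if "x \<in> ?S" for x
      using that by (force simp: B_def abs_le_iff)
    have zero: "x i = 0" if "x \<in> PiE UNIV B" "i \<notin> V" for x i
      using PiE_mem[OF that(1), of i] that(2) by (simp add: B_def)
    show ?thesis
    proof (intro equalityI subsetI)
      fix x assume x: "x \<in> PiE UNIV B \<inter> {x. (\<Sum>u\<in>V. (x u)\<^sup>2) = 1}"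
      then show "x \<in> ?S" using zero[OF IntD1[OF x]] by simp
    next
      fix x assume x: "x \<in> ?S"
      then show "x \<in> PiE UNIV B \<inter> {x. (\<Sum>u\<in>V. (x u)\<^sup>2) = 1}" using box_mem[OF x] by simp
    qed
  qed
  finally show ?thesis .
qed

text \<open>First-order condition at a minimum: a small step against the sign of \<open>p\<close>
  would make the expression negative.\<close>

lemma quadratic_nonneg_imp_linear_zero:
  fixes p q :: real
  assumes "\<And>s. 0 \<le> 2 * s * p + s\<^sup>2 * q"
  shows "p = 0"
proof (rule ccontr)
  assume "p \<noteq> 0"
  \<comment> \<open>This \<open>s\<close> minimizes the quadratic obtained by enlarging
    \<open>q\<close> to |q| + 1 > 0.\<close>
  define s where "s = - p / (\<bar>q\<bar> + 1)"
  have "2 * s * p + s\<^sup>2 * q \<le> 2 * s * p + s\<^sup>2 * (\<bar>q\<bar> + 1)"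
    by (intro add_left_mono mult_left_mono) auto
  also have "\<dots> = - (p\<^sup>2 / (\<bar>q\<bar> + 1))"
  proof -
    have "\<bar>q\<bar> + 1 \<noteq> 0" by simp
    then show ?thesis by (simp add: s_def divide_simps power2_eq_square)
  qed
  also have "\<dots> < 0" using \<open>p \<noteq> 0\<close> by simp
  finally show False using assms[of s] by simp
qed

text \<open>Rayleigh's principle: the form attains a minimum \<open>m\<close> on the unit sphere,
  scaling extends the bound to all vectors, and stationarity at the minimizer is the eigenvalue
  equation.\<close>

lemma least_eigenvalue_minimizes_quad_form:
  assumes "finite V" "V \<noteq> {}" and sym: "\<And>u v. u \<in> V \<Longrightarrow> v \<in> V \<Longrightarrow> b u v = b v u"
  shows "\<exists>m. eigenvalue_on V b m \<and> (\<forall>y. m * (\<Sum>u\<in>V. (y u)\<^sup>2) \<le> quad_form V b y)"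
proof -
  define S where "S = {x :: 'a \<Rightarrow> real. (\<forall>i. i \<notin> V \<longrightarrow> x i = 0) \<and> (\<Sum>u\<in>V. (x u)\<^sup>2) = 1}"
  obtain r where r: "r \<in> V" using assms by blast
  have "(\<Sum>u\<in>V. (if u = r then 1 else 0 :: real)\<^sup>2) = (\<Sum>u\<in>V. if u = r then 1 else 0)"
    by (intro sum.cong) auto
  then have "(\<lambda>u. if u = r then 1 else 0) \<in> S" using r assms by (auto simp: S_def)
  then have ne: "S \<noteq> {}" by blast
  have "continuous_on S (quad_form V b)"
    unfolding quad_form_def
    by (intro continuous_on_sum continuous_on_mult continuous_on_const
        continuous_on_subset[OF continuous_on_product_coordinates]) auto
  then obtain x where x: "x \<in> S" and min: "\<And>y. y \<in> S \<Longrightarrow> quad_form V b x \<le> quad_form V b y"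
    using continuous_attains_inf[OF compact_unit_vectors[OF \<open>finite V\<close>, folded S_def] ne] by blast
  define m where "m = quad_form V b x"
  have ineq: "m * (\<Sum>u\<in>V. (y u)\<^sup>2) \<le> quad_form V b y" for y
  proof (cases "(\<Sum>u\<in>V. (y u)\<^sup>2) = 0")
    case True
    then have "\<forall>u\<in>V. y u = 0" using assms by (simp add: sum_nonneg_eq_0_iff)
    then show ?thesis by (simp add: quad_form_def True)
  next
    case False
    define N where "N = (\<Sum>u\<in>V. (y u)\<^sup>2)"
    have N: "N > 0" using False by (simp add: N_def less_le sum_nonneg)
    define z where "z i = (if i \<in> V then y i / sqrt N else 0)" for i
    have "(\<Sum>u\<in>V. (z u)\<^sup>2) = (\<Sum>u\<in>V. (y u)\<^sup>2 / N)"
      using N by (intro sum.cong) (auto simp: z_def power_divide)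
    also have "\<dots> = 1" using N by (simp add: N_def sum_divide_distrib[symmetric])
    finally have "z \<in> S" by (auto simp: z_def S_def)
    then have "m \<le> quad_form V b z" using min by (simp add: m_def)
    also have "quad_form V b z = quad_form V b y / N"
      unfolding quad_form_def sum_divide_distrib
      using N by (intro sum.cong refl) (auto simp: z_def)
    finally show ?thesis using N by (simp add: N_def[symmetric] field_simps)
  qed
  have "(\<Sum>v\<in>V. b u v * x v) = m * x u" if u: "u \<in> V" for u
  proof -
    define e where "e v = (if v = u then 1 else 0 :: real)" for v
    \<comment> \<open>\<open>c\<close> is \<open>b\<close> minus \<open>m\<close> times the
      identity. Its form is nonnegative and zero at \<open>x\<close>, so the derivative at
      \<open>x\<close> along the unit vector \<open>e\<close> vanishes, which is row
      \<open>u\<close> of the eigenvalue equation.\<close>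
    define c where "c v w = b v w - (if v = w then m else 0)" for v w
    have c: "quad_form V c y = quad_form V b y - m * (\<Sum>u\<in>V. (y u)\<^sup>2)" for y
    proof -
      have "quad_form V c y = quad_form V b y - (\<Sum>u\<in>V. \<Sum>v\<in>V. if u = v then m * (y u)\<^sup>2 else 0)"
        unfolding quad_form_def sum_subtractf[symmetric]
        by (intro sum.cong refl) (auto simp: c_def algebra_simps power2_eq_square)
      also have "\<dots> = quad_form V b y - m * (\<Sum>u\<in>V. (y u)\<^sup>2)"
        using assms by (simp add: sum_distrib_left)
      finally show ?thesis .
    qed
    have cs: "c v w = c w v" if "v \<in> V" "w \<in> V" for v w
      using sym[OF that] by (simp add: c_def)
    have "0 \<le> 2 * s * (\<Sum>v\<in>V. \<Sum>w\<in>V. c v w * e v * x w) + s\<^sup>2 * quad_form V c e" for s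
    proof -
      have "quad_form V c x = 0" using x by (simp add: c m_def S_def)
      moreover have "0 \<le> quad_form V c (\<lambda>v. x v + s * e v)"
        using ineq by (simp add: c)
      ultimately show ?thesis using quad_form_add[OF cs, where x = x and s = s and y = e] by simp
    qed
    from quadratic_nonneg_imp_linear_zero[OF this]
    have "(\<Sum>v\<in>V. \<Sum>w\<in>V. c v w * e v * x w) = 0" .
    also have "(\<Sum>v\<in>V. \<Sum>w\<in>V. c v w * e v * x w) = (\<Sum>v\<in>V. if v = u then \<Sum>w\<in>V. c v w * x w else 0)"
      by (intro sum.cong) (auto simp: e_def)
    also have "\<dots> = (\<Sum>w\<in>V. c u w * x w)" using u assms by simp
    also have "\<dots> = (\<Sum>w\<in>V. b u w * x w - (if u = w then m * x w else 0))"
      by (intro sum.cong) (auto simp: c_def algebra_simps)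
    also have "\<dots> = (\<Sum>w\<in>V. b u w * x w) - m * x u"
      using u assms by (simp add: sum_subtractf)
    finally show ?thesis by simp
  qed
  moreover have "\<exists>u\<in>V. x u \<noteq> 0" using x unfolding S_def by (metis (mono_tags, lifting) mem_Collect_eq sum.neutral zero_neq_one zero_power2)
  ultimately have "eigenvalue_on V b m" unfolding eigenvalue_on_def by blast
  then show ?thesis using ineq by blast
qed

text \<open>Compare an eigenvector with \<open>y\<close> at a vertex where the quotient of their entries is largest.\<close>
lemma eigenvalue_on_bounded_by_positive_supersolution:
  assumes "finite V" "\<And>u v. u \<in> V \<Longrightarrow> v \<in> V \<Longrightarrow> b u v \<ge> 0" "\<And>u. u \<in> V \<Longrightarrow> y u > 0"
    and super: "\<And>u. u \<in> V \<Longrightarrow> (\<Sum>v\<in>V. b u v * y v) \<le> \<rho> * y u"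
    and "eigenvalue_on V b k"
  shows "\<bar>k\<bar> \<le> \<rho>"
proof -
  obtain x where x: "\<exists>u\<in>V. x u \<noteq> 0" "\<And>u. u \<in> V \<Longrightarrow> (\<Sum>v\<in>V. b u v * x v) = k * x u"
    using assms(5) unfolding eigenvalue_on_def by blast
  define f where "f u = \<bar>x u\<bar> / y u" for u
  have V: "V \<noteq> {}" using x by blast
  define M where "M = Max (f ` V)"
  have "M \<in> f ` V" unfolding M_def using V assms(1) by (intro Max_in) auto
  then obtain u where u: "u \<in> V" "f u = M" by auto
  have le: "f v \<le> M" if "v \<in> V" for v using that assms(1) by (simp add: M_def)
  have "M > 0"
  proof -
    obtain w where w: "w \<in> V" "x w \<noteq> 0" using x by blast
    then have "f w > 0" using assms(3) by (simp add: f_def)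
    then show ?thesis using le[OF w(1)] by linarith
  qed
  have xv: "\<bar>x v\<bar> \<le> M * y v" if "v \<in> V" for v
    using le[OF that] assms(3)[OF that] by (simp add: f_def field_simps)
  have xu: "\<bar>x u\<bar> = M * y u" using u assms(3)[OF u(1)] by (simp add: f_def field_simps)
  have "\<bar>k\<bar> * \<bar>x u\<bar> = \<bar>\<Sum>v\<in>V. b u v * x v\<bar>" using x u by (simp add: abs_mult)
  also have "\<dots> \<le> (\<Sum>v\<in>V. \<bar>b u v * x v\<bar>)" by (rule sum_abs)
  also have "\<dots> \<le> (\<Sum>v\<in>V. M * (b u v * y v))"
  proof (rule sum_mono)
    fix v assume v: "v \<in> V"
    have "\<bar>b u v * x v\<bar> = b u v * \<bar>x v\<bar>" using assms(2) u v by (simp add: abs_mult)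
    also have "\<dots> \<le> b u v * (M * y v)" using assms(2) u v xv by (intro mult_left_mono) auto
    finally show "\<bar>b u v * x v\<bar> \<le> M * (b u v * y v)" by (simp add: ac_simps)
  qed
  also have "\<dots> = M * (\<Sum>v\<in>V. b u v * y v)" by (simp add: sum_distrib_left)
  also have "\<dots> \<le> M * (\<rho> * y u)" using super[OF u(1)] \<open>M > 0\<close> by (intro mult_left_mono) auto
  finally have "\<bar>k\<bar> * (M * y u) \<le> \<rho> * (M * y u)" unfolding xu by (simp add: ac_simps)
  moreover have "M * y u > 0" using \<open>M > 0\<close> assms(3) u by simp
  ultimately show ?thesis by (simp add: mult_le_cancel_right)
qed

section \<open>Test vectors on rooted trees\<close>

text \<open>For a path with \<open>m\<close> vertices this is the last pivot when 2 cos theta I - A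
  is eliminated from one end, a quotient of consecutive Chebyshev polynomials of the second kind at
  cos theta. It reaches 0 when (m + 1) theta = pi.\<close>

definition sin_ratio :: "real \<Rightarrow> nat \<Rightarrow> real" where
  "sin_ratio \<theta> m = sin (real (m + 1) * \<theta>) / sin (real m * \<theta>)"

lemma sin_mult_minus_sin_mult:
  fixes a b t :: real
  shows "sin a * sin b - sin t * sin (a + b - t) = sin (a - t) * sin (b - t)"
proof -
  \<comment> \<open>The factor \<open>s * s + c * c\<close> stands for 1 and turns the claim into a
    polynomial identity in the sines and cosines of the three angles.\<close>
  have expand: "p * q * (s * s + c * c) - s * ((p * y + x * q) * c - (x * y - p * q) * s) =
      (p * c - x * s) * (q * c - y * s)" for p q x y s c :: real
    by (simp add: algebra_simps)
  have "sin (a + b - t) = (sin a * cos b + cos a * sin b) * cos t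
      - (cos a * cos b - sin a * sin b) * sin t"
    by (simp only: sin_diff sin_add cos_add)
  then show ?thesis
    using expand[of "sin a" "sin b" "sin t" "cos t" "cos b" "cos a"]
    by (simp add: sin_diff flip: power2_eq_square)
qed

text \<open>Meant for a = m theta, b = (k + 1) theta, t = theta: the left side is then the slack in
  the joining estimate for trees of sizes m and k. The factored form shows its sign and its
  zeros.\<close>

lemma sin_ratio_join_eq:
  fixes a b t :: real
  assumes "sin a \<noteq> 0" "sin b \<noteq> 0" "sin (a + b - t) \<noteq> 0"
  shows "sin (a + b) / sin (a + b - t) - (sin (a + t) / sin a - sin (b - t) / sin b) =
    sin (a + b) * sin (a - t) * sin (b - t) / (sin a * sin b * sin (a + b - t))"
proof -
  have "sin (a + t) * sin b - sin (b - t) * sin a = sin t * sin (a + b)"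
    by (simp add: sin_add sin_diff algebra_simps)
  then have "sin (a + t) / sin a - sin (b - t) / sin b = sin t * sin (a + b) / (sin a * sin b)"
    using assms by (simp add: field_simps)
  then have "sin (a + b) / sin (a + b - t) - (sin (a + t) / sin a - sin (b - t) / sin b) =
     sin (a + b) * (sin a * sin b - sin t * sin (a + b - t)) / (sin a * sin b * sin (a + b - t))"
    using assms by (simp add: field_simps)
  then show ?thesis by (simp add: sin_mult_minus_sin_mult mult.assoc)
qed

context
  fixes \<theta> :: real
  assumes pos: "\<theta> > 0"
begin

lemma sin_multiple_pos: "sin (real k * \<theta>) > 0" if "k \<ge> 1" "real k * \<theta> < pi"
  using that pos by (intro sin_gt_zero) auto

lemma sin_ratio_pos: "sin_ratio \<theta> m > 0" if "m \<ge> 1" "real (m + 1) * \<theta> < pi"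
proof -
  have "real m * \<theta> < pi" using that pos by (simp add: algebra_simps)
  then show ?thesis
    using that sin_multiple_pos[of m] sin_multiple_pos[of "m + 1"] by (simp add: sin_ratio_def)
qed

text \<open>All factors of the slack in \<open>sin_ratio_join_eq\<close> are nonnegative. It
  vanishes only if a = theta, that is m = 1, or if a + b = pi, that is at full length; the strict
  version excludes both.\<close>

lemma sin_ratio_join:
  assumes "m \<ge> 1" "k \<ge> 1" and le: "real (m + k + 1) * \<theta> \<le> pi"
  shows "sin_ratio \<theta> m - 1 / sin_ratio \<theta> k \<le> sin_ratio \<theta> (m + k)"
    and "m \<ge> 2 \<Longrightarrow> real (m + k + 1) * \<theta> < pi \<Longrightarrow>
      sin_ratio \<theta> m - 1 / sin_ratio \<theta> k < sin_ratio \<theta> (m + k)"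
proof -
  define a where "a = real m * \<theta>"
  define b where "b = real (k + 1) * \<theta>"
  have mult_lt: "real j * \<theta> < pi" if "j \<le> m + k" for j
  proof -
    have "real j * \<theta> < real (m + k + 1) * \<theta>" using that pos by (intro mult_strict_right_mono) auto
    then show ?thesis using le by linarith
  qed
  have a: "sin a > 0" unfolding a_def using assms by (intro sin_multiple_pos mult_lt) auto
  have b: "sin b > 0" unfolding b_def using assms by (intro sin_multiple_pos mult_lt) auto
  have ab: "a + b - \<theta> = real (m + k) * \<theta>" by (simp add: a_def b_def algebra_simps)
  have s: "sin (a + b - \<theta>) > 0" unfolding ab using assms by (intro sin_multiple_pos mult_lt) auto
  have bt: "b - \<theta> = real k * \<theta>" by (simp add: b_def algebra_simps)
  have sbt: "sin (b - \<theta>) > 0" unfolding bt using assms by (intro sin_multiple_pos mult_lt) auto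
  have at: "a - \<theta> = real (m - 1) * \<theta>" using assms by (simp add: a_def algebra_simps)
  have sat: "sin (a - \<theta>) \<ge> 0"
    unfolding at using less_imp_le[OF mult_lt[of "m - 1"]] pos by (intro sin_ge_zero) auto
  have sat': "sin (a - \<theta>) > 0" if "m \<ge> 2"
    unfolding at using that by (intro sin_multiple_pos mult_lt) auto
  have apb: "a + b = real (m + k + 1) * \<theta>" by (simp add: a_def b_def algebra_simps)
  have sapb: "sin (a + b) \<ge> 0"
    unfolding apb using le pos by (intro sin_ge_zero) auto
  have sapb': "sin (a + b) > 0" if "real (m + k + 1) * \<theta> < pi"
    unfolding apb using that by (intro sin_multiple_pos) auto
  have "sin_ratio \<theta> (m + k) - (sin_ratio \<theta> m - 1 / sin_ratio \<theta> k) =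
    sin (a + b) / sin (a + b - \<theta>) - (sin (a + \<theta>) / sin a - sin (b - \<theta>) / sin b)"
    unfolding ab unfolding apb bt unfolding sin_ratio_def a_def b_def by (simp add: algebra_simps)
  also have "\<dots> = sin (a + b) * sin (a - \<theta>) * sin (b - \<theta>) / (sin a * sin b * sin (a + b - \<theta>))"
    using a b s by (intro sin_ratio_join_eq) auto
  finally have eq: "sin_ratio \<theta> (m + k) - (sin_ratio \<theta> m - 1 / sin_ratio \<theta> k) = \<dots>" .
  show "sin_ratio \<theta> m - 1 / sin_ratio \<theta> k \<le> sin_ratio \<theta> (m + k)"
  proof -
    have "0 \<le> sin (a + b) * sin (a - \<theta>) * sin (b - \<theta>) / (sin a * sin b * sin (a + b - \<theta>))"
      using a b s sbt sat sapb by simp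
    then show ?thesis using eq by linarith
  qed
  show "sin_ratio \<theta> m - 1 / sin_ratio \<theta> k < sin_ratio \<theta> (m + k)"
    if "m \<ge> 2" "real (m + k + 1) * \<theta> < pi"
  proof -
    have "0 < sin (a + b) * sin (a - \<theta>) * sin (b - \<theta>) / (sin a * sin b * sin (a + b - \<theta>))"
      using a b s sbt sat'[OF that(1)] sapb'[OF that(2)] by simp
    then show ?thesis using eq by linarith
  qed
qed

end

lemma quad_form_join:
  assumes fin: "finite S" "finite S'" and disj: "S \<inter> S' = {}"
    and sym: "\<And>u w. c u w = c w u"
    and off: "\<And>u w. u \<noteq> w \<Longrightarrow> c u w \<le> 0" and "v \<in> S" "w \<in> S'" "c v w \<le> -1"
    and x: "\<And>u. x u \<ge> 0" "x v = 1" and y: "\<And>u. y u \<ge> 0" "y w = 1" and s: "s \<ge> 0"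
  shows "quad_form (S \<union> S') c (\<lambda>u. if u \<in> S then x u else s * y u)
    \<le> quad_form S c x + s\<^sup>2 * quad_form S' c y - 2 * s"
proof -
  let ?z = "\<lambda>u. if u \<in> S then x u else s * y u"
  let ?X = "\<Sum>u\<in>S. \<Sum>w\<in>S'. c u w * x u * (s * y w)"
  have q: "quad_form (S \<union> S') c ?z =
     (\<Sum>u\<in>S. \<Sum>w\<in>S. c u w * ?z u * ?z w) + (\<Sum>u\<in>S'. \<Sum>w\<in>S'. c u w * ?z u * ?z w)
     + ((\<Sum>u\<in>S. \<Sum>w\<in>S'. c u w * ?z u * ?z w) + (\<Sum>u\<in>S'. \<Sum>w\<in>S. c u w * ?z u * ?z w))"
    unfolding quad_form_def using fin disj by (simp add: sum.union_disjoint sum.distrib)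
  have c1: "(\<Sum>u\<in>S'. \<Sum>w\<in>S. c u w * ?z u * ?z w) = (\<Sum>u\<in>S. \<Sum>w\<in>S'. c u w * ?z u * ?z w)"
    by (subst sum.swap) (intro sum.cong refl, subst sym, simp)
  have c2: "(\<Sum>u\<in>S. \<Sum>w\<in>S'. c u w * ?z u * ?z w) = ?X"
    using disj by (intro sum.cong refl) auto
  have c3: "(\<Sum>u\<in>S. \<Sum>w\<in>S. c u w * ?z u * ?z w) = quad_form S c x"
    unfolding quad_form_def by (intro sum.cong refl) auto
  have c4: "(\<Sum>u\<in>S'. \<Sum>w\<in>S'. c u w * ?z u * ?z w) = s\<^sup>2 * quad_form S' c y"
    unfolding quad_form_def sum_distrib_left
    using disj by (intro sum.cong refl) (auto simp: power2_eq_square)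
  have c5: "?X \<le> - s"
  proof -
    have nonpos: "c u w * x u * (s * y w) \<le> 0" if "u \<in> S" "w \<in> S'" for u w
    proof -
      have "u \<noteq> w" using that disj by auto
      then have "c u w \<le> 0" by (rule off)
      moreover have "0 \<le> x u * (s * y w)" using x y s by simp
      ultimately show ?thesis by (simp add: mult.assoc mult_nonpos_nonneg)
    qed
    have "?X = (\<Sum>p\<in>S \<times> S'. c (fst p) (snd p) * x (fst p) * (s * y (snd p)))"
      by (simp add: sum.cartesian_product case_prod_unfold)
    also have "\<dots> \<le> (\<Sum>p\<in>{(v, w)}. c (fst p) (snd p) * x (fst p) * (s * y (snd p)))"
      using assms(6,7) fin
      by (subst sum.subset_diff[of "{(v, w)}"]) (auto intro!: sum_nonpos nonpos)
    also have "\<dots> \<le> - s" using x y s assms(8) mult_right_mono[of "c v w" "-1" s] by simp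
    finally show ?thesis .
  qed
  show ?thesis unfolding q c1 c2 c3 c4 using c5 by linarith
qed

section \<open>Rooted trees and their Hamiltonian paths\<close>

definition hamiltonian_path :: "('a \<Rightarrow> 'a \<Rightarrow> bool) \<Rightarrow> 'a set \<Rightarrow> 'a list \<Rightarrow> bool" where
  "hamiltonian_path E S vs \<longleftrightarrow> vs \<noteq> [] \<and> distinct vs \<and> set vs = S \<and> successively E vs"

text \<open>Reversing \<open>vs\<close> brings the two heads together. The result starts at the far
  end of \<open>vs\<close>, so it again starts at \<open>hd vs\<close> only if \<open>vs\<close> is
  a single vertex.\<close>

lemma hamiltonian_path_join:
  assumes "symp E" "hamiltonian_path E S vs" "hamiltonian_path E S' ws" "S \<inter> S' = {}"
    "E (hd vs) (hd ws)"
  shows "hamiltonian_path E (S \<union> S') (rev vs @ ws)"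
  using assms unfolding hamiltonian_path_def
  by (auto simp: successively_append_iff last_rev successively_rev symp_def
      elim: successively_mono)

text \<open>
  The edges of \<open>E\<close> used by the joins form a spanning tree of the vertex set; further edges of \<open>E\<close>
  are allowed, as they only decrease the quadratic form at a nonnegative vector.
\<close>
inductive rooted_tree :: "('a \<Rightarrow> 'a \<Rightarrow> bool) \<Rightarrow> 'a set \<Rightarrow> 'a \<Rightarrow> bool" for E where
  single: "rooted_tree E {v} v"
| join: "rooted_tree E S v \<Longrightarrow> rooted_tree E S' w \<Longrightarrow> S \<inter> S' = {} \<Longrightarrow> E v w \<Longrightarrow>
    rooted_tree E (S \<union> S') v"

lemma rooted_tree_root_in: "rooted_tree E S v \<Longrightarrow> v \<in> S"
  and rooted_tree_finite: "rooted_tree E S v \<Longrightarrow> finite S"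
  by (induction rule: rooted_tree.induct) auto

text \<open>Growth takes place at an arbitrary vertex, whereas \<open>join\<close> attaches at the
  root; the new leaf is passed down to the part that contains \<open>u\<close>.\<close>

lemma rooted_tree_insert:
  assumes "rooted_tree E S v" "u \<in> S" "w \<notin> S" "E u w"
  shows "rooted_tree E (insert w S) v"
  using assms
proof (induction arbitrary: u rule: rooted_tree.induct)
  case (single v)
  have "rooted_tree E ({v} \<union> {w}) v"
    using single by (intro rooted_tree.join[OF rooted_tree.single rooted_tree.single]) auto
  then show ?case by (simp add: insert_commute)
next
  case (join S v S' z)
  show ?case
  proof (cases "u \<in> S")
    case True
    then have "rooted_tree E (insert w S) v" using join by blast
    then have "rooted_tree E (insert w S \<union> S') v"
      using join by (intro rooted_tree.join) auto
    then show ?thesis by simp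
  next
    case False
    then have "rooted_tree E (insert w S') z" using join by blast
    then have "rooted_tree E (S \<union> insert w S') v"
      using join by (intro rooted_tree.join) auto
    then show ?thesis by simp
  qed
qed

text \<open>The value 1 at the root fixes the scale for later joins. Equality can survive only while
  the joins build a path, so the induction carries a Hamiltonian path as the alternative to
  strictness. Below full length it must start at the root, where the next join attaches; at full
  length \<open>sin_ratio_join\<close> is no longer strict and the root may be interior.\<close>

lemma rooted_tree_test_vector:
  fixes \<theta> :: real
  assumes "rooted_tree E S r" and pos: "\<theta> > 0" and le: "real (card S + 1) * \<theta> \<le> pi"
    and E: "symp E" "\<And>u w. E u w \<Longrightarrow> u \<noteq> w \<Longrightarrow> c u w \<le> -1"
    and c: "\<And>u w. c u w = c w u" "\<And>u w. u \<noteq> w \<Longrightarrow> c u w \<le> 0" "\<And>u. c u u \<le> 2 * cos \<theta>"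
  shows "\<exists>x. (\<forall>u. x u \<ge> 0) \<and> x r = 1 \<and> quad_form S c x \<le> sin_ratio \<theta> (card S) \<and>
    (quad_form S c x < sin_ratio \<theta> (card S) \<or> (\<exists>vs. hamiltonian_path E S vs \<and>
      (real (card S + 1) * \<theta> < pi \<longrightarrow> hd vs = r)))"
  using assms(1) le
proof (induction rule: rooted_tree.induct)
  case (single v)
  have "\<theta> < pi" using single pos by simp
  then have "sin \<theta> > 0" using pos by (intro sin_gt_zero)
  then have "sin_ratio \<theta> (card {v}) = 2 * cos \<theta>" by (simp add: sin_ratio_def sin_double)
  then have q: "quad_form {v} c (\<lambda>_. 1) \<le> sin_ratio \<theta> (card {v})"
    using c(3)[of v] by (simp add: quad_form_def)
  have "hamiltonian_path E {v} [v]" by (simp add: hamiltonian_path_def)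
  then have "\<exists>vs. hamiltonian_path E {v} vs \<and> (real (card {v} + 1) * \<theta> < pi \<longrightarrow> hd vs = v)"
    by (intro exI[of _ "[v]"]) simp
  then show ?case using q by (intro exI[of _ "\<lambda>_. 1"]) simp
next
  case (join S v S' w)
  have fin: "finite S" "finite S'" using join.hyps(1,2) by (auto dest: rooted_tree_finite)
  have vw: "v \<in> S" "w \<in> S'" using join.hyps(1,2) by (auto dest: rooted_tree_root_in)
  define m k where "m = card S" and "k = card S'"
  have mk: "card (S \<union> S') = m + k"
    unfolding m_def k_def using fin join.hyps(3) by (simp add: card_Un_disjoint)
  have m1: "m \<ge> 1" and k1: "k \<ge> 1" unfolding m_def k_def
    using fin vw by (auto simp: Suc_le_eq card_gt_0_iff)
  have le: "real (m + k + 1) * \<theta> \<le> pi" using join.prems mk by simp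
  have lt: "real (j + 1) * \<theta> < pi" if "j < m + k" for j
  proof -
    have "real (j + 1) * \<theta> < real (m + k + 1) * \<theta>"
      using that pos by (intro mult_strict_right_mono) auto
    then show ?thesis using le by linarith
  qed
  \<comment> \<open>Each part is smaller than the union, hence below full length, so the paths from
    the induction hypotheses start at the roots.\<close>
  have mlt: "real (m + 1) * \<theta> < pi" and klt: "real (k + 1) * \<theta> < pi" using lt m1 k1 by auto
  obtain x where x: "\<And>u. x u \<ge> 0" "x v = 1" "quad_form S c x \<le> sin_ratio \<theta> m"
    "quad_form S c x < sin_ratio \<theta> m \<or> (\<exists>vs. hamiltonian_path E S vs \<and> hd vs = v)"
    using join.IH(1) mlt unfolding m_def by auto
  obtain y where y: "\<And>u. y u \<ge> 0" "y w = 1" "quad_form S' c y \<le> sin_ratio \<theta> k"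
    "quad_form S' c y < sin_ratio \<theta> k \<or> (\<exists>vs. hamiltonian_path E S' vs \<and> hd vs = w)"
    using join.IH(2) klt unfolding k_def by auto
  define g where "g = sin_ratio \<theta> k"
  have g: "g > 0" unfolding g_def using pos k1 klt by (rule sin_ratio_pos)
  \<comment> \<open>The scale 1/g minimizes s^2 g - 2 s over s; the minimum is -1/g.\<close>
  define z where "z u = (if u \<in> S then x u else 1 / g * y u)" for u
  have z: "\<And>u. z u \<ge> 0" "z v = 1" using x y g vw by (auto simp: z_def)
  have qz: "quad_form (S \<union> S') c z \<le> quad_form S c x + (1 / g)\<^sup>2 * quad_form S' c y - 2 * (1 / g)"
    unfolding z_def 
  proof (rule quad_form_join)
    show "c v w \<le> -1" using E(2) join.hyps(3,4) vw by auto
  qed (use vw join.hyps(3) c x y g fin in auto)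
  have gg: "(1 / g)\<^sup>2 * g = 1 / g" using g by (simp add: power2_eq_square)
  have qy: "(1 / g)\<^sup>2 * quad_form S' c y \<le> 1 / g"
    using y(3) g mult_left_mono[of "quad_form S' c y" g "(1/g)\<^sup>2"] unfolding gg by (simp add: g_def)
  have qy': "(1 / g)\<^sup>2 * quad_form S' c y < 1 / g" if "quad_form S' c y < g"
    using that g mult_strict_left_mono[of "quad_form S' c y" g "(1/g)\<^sup>2"] unfolding gg by simp
  note J = sin_ratio_join[OF pos m1 k1 le, folded g_def]
  have main: "quad_form (S \<union> S') c z \<le> sin_ratio \<theta> (m + k)"
    using qz qy x(3) J(1) by linarith
  have "quad_form (S \<union> S') c z < sin_ratio \<theta> (m + k) \<or> (\<exists>vs. hamiltonian_path E (S \<union> S') vs \<and>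
      (real (m + k + 1) * \<theta> < pi \<longrightarrow> hd vs = v))"
  proof (cases "quad_form S c x < sin_ratio \<theta> m \<or> quad_form S' c y < g")
    case True
    then have "quad_form (S \<union> S') c z < sin_ratio \<theta> (m + k)"
      using qz qy qy' x(3) J(1) by fastforce
    then show ?thesis ..
  next
    case False
    then obtain vs ws where p: "hamiltonian_path E S vs" "hd vs = v"
      "hamiltonian_path E S' ws" "hd ws = w"
      using x(4) y(4) unfolding g_def by blast
    have P: "hamiltonian_path E (S \<union> S') (rev vs @ ws)"
      using hamiltonian_path_join[OF E(1) p(1,3) join.hyps(3)] join.hyps(4) p(2,4) by simp
    show ?thesis
    \<comment> \<open>Equality is left only for m = 1 or at full length. If m = 1, reversal changes
      nothing and the new path still starts at the root; at full length no start is
      demanded.\<close>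
    proof (cases "real (m + k + 1) * \<theta> < pi \<and> m \<ge> 2")
      case True
      then have "quad_form (S \<union> S') c z < sin_ratio \<theta> (m + k)"
        using qz qy x(3) J(2) by linarith
      then show ?thesis ..
    next
      case False
      have "hd (rev vs @ ws) = v" if "real (m + k + 1) * \<theta> < pi"
      proof -
        have "m = 1" using that False m1 by auto
        then have "length vs = 1"
          using p(1) unfolding m_def hamiltonian_path_def by (metis distinct_card)
        then have "vs = [v]" using p(2) by (cases vs) auto
        then show ?thesis by simp
      qed
      then show ?thesis using P by blast
    qed
  qed
  then show ?case using main z unfolding mk by blast
qed

section \<open>Eccentricity matrices of complements\<close>

lemma eigenvalue_on_bij:
  assumes "bij_betw \<phi> V W" "\<And>u v. u \<in> V \<Longrightarrow> v \<in> V \<Longrightarrow> b' (\<phi> u) (\<phi> v) = b u v"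
  shows "eigenvalue_on V b k \<longleftrightarrow> eigenvalue_on W b' k"
proof
  assume "eigenvalue_on V b k"
  then obtain x where x: "\<exists>u\<in>V. x u \<noteq> 0" "\<forall>u\<in>V. (\<Sum>v\<in>V. b u v * x v) = k * x u"
    unfolding eigenvalue_on_def by blast
  define y where "y = (\<lambda>w. x (the_inv_into V \<phi> w))"
  have inj: "inj_on \<phi> V" and W: "W = \<phi> ` V" using assms(1) by (auto simp: bij_betw_def)
  have y: "y (\<phi> u) = x u" if "u \<in> V" for u
    using the_inv_into_f_f[OF inj that] by (simp add: y_def)
  have "(\<Sum>v\<in>W. b' (\<phi> u) v * y v) = k * y (\<phi> u)" if "u \<in> V" for u
  proof -
    have "(\<Sum>v\<in>W. b' (\<phi> u) v * y v) = (\<Sum>v\<in>V. b' (\<phi> u) (\<phi> v) * y (\<phi> v))"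
      unfolding W by (simp add: sum.reindex[OF inj])
    also have "\<dots> = (\<Sum>v\<in>V. b u v * x v)" using that by (intro sum.cong) (auto simp: assms(2) y)
    finally show ?thesis using x(2) that y by simp
  qed
  moreover have "\<exists>w\<in>W. y w \<noteq> 0" using x(1) y unfolding W by auto
  ultimately show "eigenvalue_on W b' k"
    unfolding eigenvalue_on_def W by (intro exI[of _ y]) auto
next
  assume "eigenvalue_on W b' k"
  then obtain y where y: "\<exists>u\<in>W. y u \<noteq> 0" "\<forall>u\<in>W. (\<Sum>v\<in>W. b' u v * y v) = k * y u"
    unfolding eigenvalue_on_def by blast
  have inj: "inj_on \<phi> V" and W: "W = \<phi> ` V" using assms(1) by (auto simp: bij_betw_def)
  have "(\<Sum>v\<in>V. b u v * y (\<phi> v)) = k * y (\<phi> u)" if "u \<in> V" for u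
  proof -
    have "(\<Sum>v\<in>V. b u v * y (\<phi> v)) = (\<Sum>v\<in>V. b' (\<phi> u) (\<phi> v) * y (\<phi> v))"
      using that by (intro sum.cong) (auto simp: assms(2))
    also have "\<dots> = (\<Sum>v\<in>W. b' (\<phi> u) v * y v)" unfolding W by (simp add: sum.reindex[OF inj])
    finally show ?thesis using y(2) that W by simp
  qed
  moreover have "\<exists>u\<in>V. y (\<phi> u) \<noteq> 0" using y(1) unfolding W by auto
  ultimately show "eigenvalue_on V b k"
    unfolding eigenvalue_on_def by (intro exI[of _ "y \<circ> \<phi>"]) auto
qed

lemma eigenvalue_mat_iff:
  fixes b :: "nat \<Rightarrow> nat \<Rightarrow> real"
  shows "eigenvalue (mat n n (\<lambda>(i, j). b i j)) k \<longleftrightarrow> eigenvalue_on {0..<n} b k"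
proof
  let ?A = "mat n n (\<lambda>(i, j). b i j)"
  assume "eigenvalue ?A k"
  then obtain v where v: "v \<in> carrier_vec n" "v \<noteq> 0\<^sub>v n" "?A *\<^sub>v v = k \<cdot>\<^sub>v v"
    unfolding eigenvalue_def eigenvector_def by auto
  have "\<exists>i\<in>{0..<n}. v $ i \<noteq> 0"
  proof (rule ccontr)
    assume "\<not> ?thesis"
    then have "v = 0\<^sub>v n" using v(1) by (intro eq_vecI) auto
    then show False using v(2) by simp
  qed
  moreover have "(\<Sum>j\<in>{0..<n}. b i j * v $ j) = k * v $ i" if "i \<in> {0..<n}" for i
  proof -
    have "(?A *\<^sub>v v) $ i = (\<Sum>j\<in>{0..<n}. b i j * v $ j)"
      using that v(1) by (simp add: scalar_prod_def)
    moreover have "(k \<cdot>\<^sub>v v) $ i = k * v $ i" using that v(1) by simp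
    ultimately show ?thesis using v(3) by simp
  qed
  ultimately show "eigenvalue_on {0..<n} b k"
    unfolding eigenvalue_on_def by (intro exI[of _ "\<lambda>i. v $ i"]) auto
next
  let ?A = "mat n n (\<lambda>(i, j). b i j)"
  assume "eigenvalue_on {0..<n} b k"
  then obtain x where x: "\<exists>i\<in>{0..<n}. x i \<noteq> 0" "\<forall>i\<in>{0..<n}. (\<Sum>j\<in>{0..<n}. b i j * x j) = k * x i"
    unfolding eigenvalue_on_def by blast
  have "?A *\<^sub>v vec n x = k \<cdot>\<^sub>v vec n x"
    using x(2) by (intro eq_vecI) (auto simp: scalar_prod_def)
  moreover have "vec n x \<noteq> 0\<^sub>v n"
  proof
    assume "vec n x = 0\<^sub>v n"
    then have "vec n x $ i = 0" if "i < n" for i using that by simp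
    then show False using x(1) by auto
  qed
  ultimately show "eigenvalue ?A k"
    unfolding eigenvalue_def eigenvector_def by (intro exI[of _ "vec n x"]) auto
qed

text \<open>The enumeration chosen inside \<open>ecc_matrix\<close> drops out, as any bijection onto
  the vertices carries eigenvectors back and forth.\<close>

lemma spectrum_ecc_matrix:
  assumes "finite (pverts G)"
  shows "spectrum (ecc_matrix G) = {k. eigenvalue_on (pverts G) (ecc_entry G) k}"
proof -
  define f where "f = (SOME f. bij_betw f {0..<card (pverts G)} (pverts G))"
  have f: "bij_betw f {0..<card (pverts G)} (pverts G)"
    unfolding f_def using ex_bij_betw_nat_finite[OF assms] by (rule someI_ex)
  have "ecc_matrix G = mat (card (pverts G)) (card (pverts G)) (\<lambda>(i, j). ecc_entry G (f i) (f j))"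
    by (simp add: ecc_matrix_def Let_def f_def)
  then show ?thesis
    unfolding spectrum_def
    using eigenvalue_mat_iff[of "card (pverts G)" "\<lambda>i j. ecc_entry G (f i) (f j)"]
      eigenvalue_on_bij[OF f, of "ecc_entry G" "\<lambda>i j. ecc_entry G (f i) (f j)"]
    by (intro Collect_cong) simp
qed

lemma finite_spectrum_ecc_matrix: "finite (spectrum (ecc_matrix G))"
  by (rule card_finite_spectrum[of _ "card (pverts G)"]) (simp add: ecc_matrix_def Let_def)

section \<open>Distances and eccentricities in complements\<close>

lemma (in wf_digraph) min_cost_unit:
  assumes "awalk u p v" "\<And>q. awalk u q v \<Longrightarrow> length p \<le> length q"
  shows "\<mu> (\<lambda>_. 1) u v = ereal (length p)"
proof -
  have cost: "awalk_cost (\<lambda>_. 1) q = real (length q)" for q :: "'b list"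
    by (induction q) auto
  show ?thesis unfolding \<mu>_def cost
    by (intro antisym INF_lower2[of p] INF_greatest) (use assms in auto)
qed

text \<open>The exhibited walk makes the distance finite, so the conversion to reals in
  \<open>graph_dist\<close> loses nothing.\<close>

lemma graph_dist_eqI:
  assumes "pair_wf_digraph H" "pre_digraph.awalk (with_proj H) u p v"
    "\<And>q. pre_digraph.awalk (with_proj H) u q v \<Longrightarrow> length p \<le> length q"
  shows "graph_dist H u v = real (length p)"
proof -
  interpret pair_wf_digraph H by fact
  show ?thesis unfolding graph_dist_def by (subst min_cost_unit[OF assms(2,3)]) auto
qed

text \<open>The properties of trees other than stars that determine distances in the complement.\<close>
locale ecc_complement =
  fixes G :: "'a pair_pre_digraph"
  assumes finite_verts: "finite (pverts G)"
    and arc_verts: "(u, v) \<in> parcs G \<Longrightarrow> u \<in> pverts G"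
    and arc_sym: "(u, v) \<in> parcs G \<Longrightarrow> (v, u) \<in> parcs G"
    and arc_irrefl: "(u, u) \<notin> parcs G"
    and triangle_free: "(a, b) \<in> parcs G \<Longrightarrow> (b, c) \<in> parcs G \<Longrightarrow> (c, a) \<notin> parcs G"
    and four_cycle_free: "(a, b) \<in> parcs G \<Longrightarrow> (b, c) \<in> parcs G \<Longrightarrow> (c, d) \<in> parcs G \<Longrightarrow>
      a \<noteq> c \<Longrightarrow> b \<noteq> d \<Longrightarrow> (d, a) \<notin> parcs G"
    and no_isolated: "u \<in> pverts G \<Longrightarrow> \<exists>v. (u, v) \<in> parcs G"
    and no_dominating: "u \<in> pverts G \<Longrightarrow> \<exists>v\<in>pverts G. v \<noteq> u \<and> (u, v) \<notin> parcs G"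
begin

text \<open>These are the dominating edges: in the complement their ends have no common neighbour,
  which is what makes them remote there.\<close>

definition remote_edge :: "'a \<Rightarrow> 'a \<Rightarrow> bool" where
  "remote_edge u v \<longleftrightarrow> (u, v) \<in> parcs G \<and>
     (\<forall>w\<in>pverts G. w = u \<or> w = v \<or> (u, w) \<in> parcs G \<or> (v, w) \<in> parcs G)"

lemma complement_arcs:
  "(u, v) \<in> parcs (complement_graph G) \<longleftrightarrow>
     u \<in> pverts G \<and> v \<in> pverts G \<and> u \<noteq> v \<and> (u, v) \<notin> parcs G"
  and complement_verts: "pverts (complement_graph G) = pverts G"
  by (auto simp: complement_graph_def)

lemma complement_wf: "pair_wf_digraph (complement_graph G)"
  by unfold_locales (auto simp: complement_graph_def)

lemma arc_sym_iff: "(u, v) \<in> parcs G \<longleftrightarrow> (v, u) \<in> parcs G"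
  using arc_sym by blast

lemma remote_edge_sym: "remote_edge u v \<longleftrightarrow> remote_edge v u"
  unfolding remote_edge_def by (auto simp: arc_sym_iff[of u v])

lemma complement_awalk:
  "pre_digraph.awalk (with_proj (complement_graph G)) u [] v \<longleftrightarrow> u \<in> pverts G \<and> u = v"
  "pre_digraph.awalk (with_proj (complement_graph G)) u (e # q) v \<longleftrightarrow>
     e \<in> parcs (complement_graph G) \<and> fst e = u \<and>
     pre_digraph.awalk (with_proj (complement_graph G)) (snd e) q v"
proof -
  interpret pair_wf_digraph "complement_graph G" by (rule complement_wf)
  show "awalk u [] v \<longleftrightarrow> u \<in> pverts G \<and> u = v"
    by (auto simp: awalk_Nil_iff complement_verts)
  show "awalk u (e # q) v \<longleftrightarrow> e \<in> parcs (complement_graph G) \<and> fst e = u \<and> awalk (snd e) q v"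
    by (auto simp: awalk_Cons_iff)
qed

lemmas complement_dist_eqI = graph_dist_eqI[OF complement_wf]

text \<open>In the complement, a midpoint between vertices adjacent in \<open>G\<close> is a vertex
  adjacent in \<open>G\<close> to neither. A remote edge has none, so a walk of length 3 must be
  found instead.\<close>

lemma complement_dist:
  assumes u: "u \<in> pverts G" and v: "v \<in> pverts G"
  shows "graph_dist (complement_graph G) u v =
    (if u = v then 0 else if (u, v) \<notin> parcs G then 1 else if \<not> remote_edge u v then 2 else 3)"
proof -
  let ?walk = "pre_digraph.awalk (with_proj (complement_graph G))"
  have len1: "q \<noteq> []" if "?walk u q v" "u \<noteq> v" for q
    using that complement_awalk(1) by auto
  have len2: "length q \<ge> 2" if q: "?walk u q v" "(u, v) \<in> parcs G" for q
  proof -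
    have "u \<noteq> v" using that(2) arc_irrefl by auto
    then obtain e q' where e: "q = e # q'" using len1[OF q(1)] by (cases q) auto
    have "q' \<noteq> []"
      using q unfolding e by (cases e) (auto simp: complement_awalk complement_arcs)
    then show ?thesis using e by (cases q') auto
  qed
  consider "u = v" | "u \<noteq> v" "(u, v) \<notin> parcs G" | "(u, v) \<in> parcs G" "\<not> remote_edge u v"
    | "remote_edge u v" by blast
  then show ?thesis
  proof cases
    case 1
    have "graph_dist (complement_graph G) u v = real (length ([] :: ('a \<times> 'a) list))"
      by (rule complement_dist_eqI) (use u 1 in \<open>auto simp: complement_awalk\<close>)
    then show ?thesis using 1 by simp
  next
    case 2
    have "graph_dist (complement_graph G) u v = real (length [(u, v)])"
    proof (rule complement_dist_eqI)
      show "?walk u [(u, v)] v" using u v 2 by (auto simp: complement_awalk complement_arcs)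
      fix q assume "?walk u q v"
      from len1[OF this 2(1)] show "length [(u, v)] \<le> length q" by (cases q) auto
    qed
    then show ?thesis using 2 by simp
  next
    case 3
    then obtain w where w: "w \<in> pverts G" "w \<noteq> u" "w \<noteq> v" "(u, w) \<notin> parcs G" "(v, w) \<notin> parcs G"
      unfolding remote_edge_def by auto
    have "graph_dist (complement_graph G) u v = real (length [(u, w), (w, v)])"
    proof (rule complement_dist_eqI)
      show "?walk u [(u, w), (w, v)] v"
        using u v w arc_sym by (auto simp: complement_awalk complement_arcs)
      fix q assume "?walk u q v"
      from len2[OF this 3(1)] show "length [(u, w), (w, v)] \<le> length q" by simp
    qed
    then show ?thesis using 3 arc_irrefl by auto
  next
    case 4
    then have uv: "(u, v) \<in> parcs G" by (simp add: remote_edge_def)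
    have dom: "(u, w) \<in> parcs G \<or> (v, w) \<in> parcs G" if "w \<in> pverts G" "w \<noteq> u" "w \<noteq> v" for w
      using 4 that unfolding remote_edge_def by blast
    \<comment> \<open>\<open>a\<close> is missed by \<open>v\<close> and hence adjacent to
      \<open>u\<close>; for \<open>b\<close> it is the other way round. An arc between them would
      close the four-cycle a, u, v, b, so u, b, a, v is a walk in the complement.\<close>
    obtain a where a: "a \<in> pverts G" "a \<noteq> v" "(v, a) \<notin> parcs G" using no_dominating[OF v] by blast
    obtain b where b: "b \<in> pverts G" "b \<noteq> u" "(u, b) \<notin> parcs G" using no_dominating[OF u] by blast
    have au: "a \<noteq> u" using a uv arc_sym by auto
    have bv: "b \<noteq> v" using b uv by auto
    have ua: "(u, a) \<in> parcs G" using dom[of a] a au by blast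
    have vb: "(v, b) \<in> parcs G" using dom[of b] b bv by blast
    have ba: "b \<noteq> a" using ua b by auto
    have nab: "(b, a) \<notin> parcs G"
      using four_cycle_free[of a u v b] ua uv vb arc_sym a(2) b(2) by blast
    have len3: "length q \<ge> 3" if q: "?walk u q v" for q
    proof -
      obtain e f q' where q': "q = e # f # q'"
        using len2[OF q uv] by (cases q; cases "tl q") auto
      have "q' \<noteq> []"
      proof
        assume "q' = []"
        then have "(u, snd e) \<in> parcs (complement_graph G)" "(snd e, v) \<in> parcs (complement_graph G)"
          using q unfolding q' by (cases e; cases f; auto simp: complement_awalk)+
        then show False using dom[of "snd e"] arc_sym by (auto simp: complement_arcs)
      qed
      then show ?thesis unfolding q' by (cases q') auto
    qed
    have "graph_dist (complement_graph G) u v = real (length [(u, b), (b, a), (a, v)])"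
    proof (rule complement_dist_eqI)
      show "?walk u [(u, b), (b, a), (a, v)] v"
        using u v a b ba nab arc_sym by (auto simp: complement_awalk complement_arcs)
      fix q assume "?walk u q v"
      from len3[OF this] show "length [(u, b), (b, a), (a, v)] \<le> length q" by simp
    qed
    then show ?thesis using 4 uv arc_irrefl by auto
  qed
qed

lemma complement_dist_le_ecc:
  "v \<in> pverts G \<Longrightarrow> graph_dist (complement_graph G) u v \<le> eccentricity (complement_graph G) u"
  unfolding eccentricity_def complement_verts using finite_verts by simp

lemma complement_ecc_obtain:
  assumes "u \<in> pverts G"
  obtains v where "v \<in> pverts G"
    "eccentricity (complement_graph G) u = graph_dist (complement_graph G) u v"
proof -
  have "eccentricity (complement_graph G) u \<in> graph_dist (complement_graph G) u ` pverts G"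
    unfolding eccentricity_def complement_verts using finite_verts assms by (intro Max_in) auto
  then show ?thesis using that by auto
qed

lemma complement_ecc_ge_2:
  assumes "u \<in> pverts G" shows "eccentricity (complement_graph G) u \<ge> 2"
proof -
  obtain v where v: "(u, v) \<in> parcs G" using no_isolated assms by blast
  then have "v \<in> pverts G" using arc_sym arc_verts by blast
  then show ?thesis using complement_dist_le_ecc[of v u] complement_dist[OF assms, of v] v arc_irrefl
    by (auto split: if_splits)
qed

lemma complement_ecc_gt_2:
  assumes "u \<in> pverts G" "eccentricity (complement_graph G) u > 2"
  shows "\<exists>v. remote_edge u v"
proof -
  obtain v where "v \<in> pverts G"
    "eccentricity (complement_graph G) u = graph_dist (complement_graph G) u v"
    using complement_ecc_obtain[OF assms(1)] .
  then show ?thesis using assms complement_dist[OF assms(1)] by (auto split: if_splits)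
qed

lemma complement_ecc_le_3:
  assumes "u \<in> pverts G" shows "eccentricity (complement_graph G) u \<le> 3"
proof -
  obtain v where "v \<in> pverts G"
    "eccentricity (complement_graph G) u = graph_dist (complement_graph G) u v"
    using complement_ecc_obtain[OF assms(1)] .
  then show ?thesis using complement_dist[OF assms(1)] by simp
qed

text \<open>Otherwise u' differs from v and is dominated by the edge v v', which closes a triangle
  or a four-cycle. Consequently an edge that is not remote has an end of eccentricity 2 in the
  complement.\<close>

lemma remote_edge_between_remote_edges:
  assumes "(u, v) \<in> parcs G" "remote_edge u u'" "remote_edge v v'"
  shows "remote_edge u v"
proof (rule ccontr)
  assume n: "\<not> remote_edge u v"
  have uu': "(u, u') \<in> parcs G" and vv': "(v, v') \<in> parcs G"
    using assms by (auto simp: remote_edge_def)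
  have ne: "u' \<noteq> v" "v' \<noteq> u" using n assms remote_edge_sym by auto
  have "u' \<in> pverts G" using uu' arc_sym arc_verts by blast
  then consider "u' = v" | "u' = v'" | "(v, u') \<in> parcs G" | "(v', u') \<in> parcs G"
    using assms(3) unfolding remote_edge_def by blast
  then show False
  proof cases
    case 2
    then show False using triangle_free[of u v u'] assms(1) uu' vv' arc_sym by blast
  next
    case 3
    then show False using triangle_free[of u v u'] assms(1) uu' arc_sym by blast
  next
    case 4
    then show False using four_cycle_free[of u v v' u'] assms(1) uu' vv' ne arc_sym by blast
  qed (use ne in simp)
qed

text \<open>Eccentricities in the complement lie between 2 and 3. Hence distances 0 and 1 give zero
  entries, distance 3 equals both eccentricities, and distance 2 equals the smaller one by
  \<open>remote_edge_between_remote_edges\<close>.\<close>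

lemma ecc_entry_complement:
  assumes u: "u \<in> pverts G" and v: "v \<in> pverts G"
  shows "ecc_entry (complement_graph G) u v =
    (if (u, v) \<in> parcs G then if remote_edge u v then 3 else 2 else 0)"
proof -
  let ?d = "graph_dist (complement_graph G)" and ?e = "eccentricity (complement_graph G)"
  have e: "?e u \<ge> 2" "?e v \<ge> 2" "?e u \<le> 3" "?e v \<le> 3"
    using complement_ecc_ge_2 complement_ecc_le_3 u v by auto
  have sym: "?d u v = ?d v u"
    using complement_dist[OF u v] complement_dist[OF v u] arc_sym_iff[of u v] remote_edge_sym[of u v]
    by simp
  have le: "?d u v \<le> ?e u" "?d u v \<le> ?e v"
    using complement_dist_le_ecc[OF v, of u] complement_dist_le_ecc[OF u, of v] sym by auto
  show ?thesis
  proof (cases "(u, v) \<in> parcs G")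
    case False
    then have "?d u v \<le> 1" using complement_dist[OF u v] by simp
    then show ?thesis using False e by (simp add: ecc_entry_def)
  next
    case True
    then have uv: "u \<noteq> v" using arc_irrefl by auto
    show ?thesis
    proof (cases "remote_edge u v")
      case r: True
      then have "?d u v = 3" using complement_dist[OF u v] True uv by simp
      then show ?thesis using True r le e by (simp add: ecc_entry_def)
    next
      case r: False
      then have d: "?d u v = 2" using complement_dist[OF u v] True uv by simp
      have "?e u = 2 \<or> ?e v = 2"
      proof (rule ccontr)
        assume "\<not> ?thesis"
        then have "?e u > 2" "?e v > 2" using e by auto
        then obtain u' v' where "remote_edge u u'" "remote_edge v v'"
          using complement_ecc_gt_2 u v by blast
        then show False using remote_edge_between_remote_edges True r by blast
      qed
      then show ?thesis using True r d e by (auto simp: ecc_entry_def min_def)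
    qed
  qed
qed

end

section \<open>Finite trees\<close>

text \<open>Provides the path inside the part built so far that a second edge to a new vertex would
  close to a cycle.\<close>

lemma rooted_tree_path:
  assumes "rooted_tree E S r" "symp E"
  shows "u \<in> S \<Longrightarrow> u' \<in> S \<Longrightarrow>
    \<exists>vs. vs \<noteq> [] \<and> distinct vs \<and> set vs \<subseteq> S \<and> successively E vs \<and> hd vs = u \<and> last vs = u'"
  using assms(1)
proof (induction arbitrary: u u' rule: rooted_tree.induct)
  case (single v)
  then show ?case by (intro exI[of _ "[v]"]) auto
next
  case (join S v S' w)
  let ?P = "\<lambda>A a b vs. vs \<noteq> [] \<and> distinct vs \<and> set vs \<subseteq> A \<and> successively E vs \<and> hd vs = a \<and> last vs = b"
  have vw: "v \<in> S" "w \<in> S'" using join.hyps(1,2) by (auto dest: rooted_tree_root_in)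
  have rev: "?P A b a (rev vs)" if "?P A a b vs" for A a b vs
  proof -
    have "successively (\<lambda>x y. E y x) vs"
      using that assms(2) by (auto elim!: successively_mono simp: symp_def)
    then show ?thesis using that by (simp add: hd_rev last_rev successively_rev)
  qed
  have across: "\<exists>vs. ?P (S \<union> S') a b vs" if ab: "a \<in> S" "b \<in> S'" for a b
  proof -
    obtain vs where vs: "?P S a v vs" using join.IH(1)[OF ab(1) vw(1)] by blast
    obtain ws where ws: "?P S' w b ws" using join.IH(2)[OF vw(2) ab(2)] by blast
    have "?P (S \<union> S') a b (vs @ ws)"
      using vs ws join.hyps(3,4) by (auto simp: successively_append_iff)
    then show ?thesis ..
  qed
  consider "u \<in> S" "u' \<in> S" | "u \<in> S'" "u' \<in> S'" | "u \<in> S" "u' \<in> S'" | "u \<in> S'" "u' \<in> S"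
    using join.prems by auto
  then show ?case
  proof cases
    case 1
    then obtain vs where "?P S u u' vs" using join.IH(1) by blast
    then show ?thesis by (intro exI[of _ vs]) auto
  next
    case 2
    then obtain vs where "?P S' u u' vs" using join.IH(2) by blast
    then show ?thesis by (intro exI[of _ vs]) auto
  next
    case 3
    then show ?thesis by (rule across)
  next
    case 4
    then obtain vs where "?P (S \<union> S') u' u vs" using across by blast
    then have "?P (S \<union> S') u u' (rev vs)" by (rule rev)
    then show ?thesis ..
  qed
qed

text \<open>Trees in the form used for growing them: cycles are closed vertex lists, and
  connectedness says that an edge leaves every nonempty proper part.\<close>

locale acyclic_connected =
  fixes V :: "'a set" and E :: "'a \<Rightarrow> 'a \<Rightarrow> bool"
  assumes finite: "finite V" and nonempty: "V \<noteq> {}"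
    and E_in: "E u v \<Longrightarrow> u \<in> V" and E_sym: "E u v \<Longrightarrow> E v u" and E_irrefl: "\<not> E u u"
    and acyclic: "distinct vs \<Longrightarrow> length vs \<ge> 3 \<Longrightarrow> successively E vs \<Longrightarrow> \<not> E (last vs) (hd vs)"
    and connected: "S \<subseteq> V \<Longrightarrow> S \<noteq> {} \<Longrightarrow> S \<noteq> V \<Longrightarrow> \<exists>u\<in>S. \<exists>w\<in>V - S. E u w"
begin

lemma symp_E: "symp E"
  using E_sym by (auto simp: symp_def)

lemma triangle_free: "E a b \<Longrightarrow> E b c \<Longrightarrow> \<not> E c a"
  using acyclic[of "[a, b, c]"] E_irrefl E_sym by (auto dest: E_sym)

lemma four_cycle_free: "E a b \<Longrightarrow> E b c \<Longrightarrow> E c d \<Longrightarrow> a \<noteq> c \<Longrightarrow> b \<noteq> d \<Longrightarrow> \<not> E d a"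
  using acyclic[of "[a, b, c, d]"] E_irrefl by (cases "a = b \<or> b = c \<or> c = d \<or> d = a") auto

text \<open>A path in \<open>S\<close> between two different neighbours of \<open>w\<close> would
  close through \<open>w\<close> to a cycle.\<close>

lemma unique_neighbour:
  assumes "rooted_tree E S r" "u \<in> S" "u' \<in> S" "w \<notin> S" "E u w" "E u' w"
  shows "u' = u"
proof (rule ccontr)
  assume ne: "u' \<noteq> u"
  obtain vs where vs: "vs \<noteq> []" "distinct vs" "set vs \<subseteq> S" "successively E vs"
    "hd vs = u" "last vs = u'"
    using rooted_tree_path[OF assms(1) symp_E assms(2,3)] by blast
  have "length vs \<ge> 2" using vs ne by (cases vs; cases "tl vs") auto
  moreover have "successively E (vs @ [w])"
    using vs assms by (auto simp: successively_append_iff)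
  ultimately show False
    using acyclic[of "vs @ [w]"] vs assms E_sym by auto
qed

text \<open>
  Grown vertex by vertex: a new vertex has only one neighbour in the part built so far, as a second
  one would close a cycle, so it can be given the opposite sign.
\<close>
lemma coloured_subtree:
  assumes "r \<in> V" "1 \<le> k" "k \<le> card V"
  shows "\<exists>S \<epsilon>. S \<subseteq> V \<and> card S = k \<and> rooted_tree E S r \<and>
    (\<forall>u. \<epsilon> u = 1 \<or> \<epsilon> u = (-1::real)) \<and> (\<forall>u\<in>S. \<forall>v\<in>S. E u v \<longrightarrow> \<epsilon> u = - \<epsilon> v)"
  using assms(2,3)
proof (induction k rule: nat_induct_at_least)
  case base
  then show ?case using assms E_irrefl
    by (intro exI[of _ "{r}"] exI[of _ "\<lambda>_. 1"]) (auto intro: rooted_tree.single)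
next
  case (Suc k)
  then obtain S \<epsilon> where S: "S \<subseteq> V" "card S = k" "rooted_tree E S r"
    and \<epsilon>: "\<forall>u. \<epsilon> u = 1 \<or> \<epsilon> u = (-1::real)" "\<forall>u\<in>S. \<forall>v\<in>S. E u v \<longrightarrow> \<epsilon> u = - \<epsilon> v"
    by auto
  have "S \<noteq> {}" using rooted_tree_root_in[OF S(3)] by auto
  moreover have "S \<noteq> V" using S Suc.prems by auto
  ultimately obtain u w where uw: "u \<in> S" "w \<in> V" "w \<notin> S" "E u w" using connected[OF S(1)] by blast
  define \<delta> where "\<delta> = \<epsilon>(w := - \<epsilon> u)"
  have "\<delta> v = 1 \<or> \<delta> v = -1" for v
    using \<epsilon>(1)[rule_format, of v] \<epsilon>(1)[rule_format, of u] by (auto simp: \<delta>_def)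
  moreover have "\<delta> v = - \<delta> z" if vz: "v \<in> insert w S" "z \<in> insert w S" "E v z" for v z
  proof -
    consider "v = w" "z = w" | "v = w" "z \<in> S" | "v \<in> S" "z = w" | "v \<in> S" "z \<in> S"
      using vz by auto
    then show ?thesis
    proof cases
      case 1
      then show ?thesis using vz E_irrefl by auto
    next
      case 2
      then have "z = u" using unique_neighbour[OF S(3) uw(1) 2(2) uw(3,4)] vz E_sym by auto
      then show ?thesis using 2 uw by (auto simp: \<delta>_def)
    next
      case 3
      then have "v = u" using unique_neighbour[OF S(3) uw(1) 3(1) uw(3,4)] vz by auto
      then show ?thesis using 3 uw by (auto simp: \<delta>_def)
    next
      case 4
      then show ?thesis using \<epsilon>(2) vz uw by (auto simp: \<delta>_def)
    qed
  qed
  moreover have "rooted_tree E (insert w S) r" using rooted_tree_insert[OF S(3) uw(1,3,4)] .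
  moreover have "card (insert w S) = Suc k"
    using S uw finite by (simp add: finite_subset[OF S(1) finite])
  ultimately show ?case using S uw by (intro exI[of _ "insert w S"] exI[of _ \<delta>]) auto
qed

text \<open>The signs of the bipartition: multiplying a vector by them negates every edge term of
  the form, so large adjacency eigenvalues turn into small ones.\<close>

lemma coloured_spanning_tree:
  assumes "r \<in> V"
  obtains \<epsilon> where "rooted_tree E V r" "\<And>u. \<epsilon> u = 1 \<or> \<epsilon> u = (-1::real)"
    "\<And>u v. E u v \<Longrightarrow> \<epsilon> u = - \<epsilon> v"
proof -
  have "1 \<le> card V" using finite nonempty by (simp add: Suc_le_eq card_gt_0_iff)
  then obtain S \<epsilon> where S: "S \<subseteq> V" "card S = card V" "rooted_tree E S r"
    and \<epsilon>: "\<forall>u. \<epsilon> u = 1 \<or> \<epsilon> u = (-1::real)" "\<forall>u\<in>S. \<forall>v\<in>S. E u v \<longrightarrow> \<epsilon> u = - \<epsilon> v"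
    using coloured_subtree[OF assms, of "card V"] by auto
  have "S = V" using S finite by (simp add: card_subset_eq)
  then show ?thesis using that[of \<epsilon>] S \<epsilon> E_in E_sym by metis
qed

text \<open>A chord would close the segment between its ends to a cycle. So a tree with a
  Hamiltonian path is itself a path.\<close>

lemma hamiltonian_path_adjacent_iff:
  assumes "hamiltonian_path E V vs" and "i < length vs" "j < length vs"
  shows "E (vs ! i) (vs ! j) \<longleftrightarrow> j = Suc i \<or> i = Suc j"
proof
  have vs: "distinct vs" "successively E vs" using assms(1) by (auto simp: hamiltonian_path_def)
  have aux: "j \<le> Suc i" if "E (vs ! i) (vs ! j)" "i < length vs" "j < length vs" for i j
  proof (rule ccontr)
    assume "\<not> ?thesis"
    then have ij: "i + 2 \<le> j" by simp
    \<comment> \<open>The segment from index \<open>i\<close> to index \<open>j\<close>, both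
      included; it has at least 3 vertices.\<close>
    define ws where "ws = take (j - i + 1) (drop i vs)"
    have len: "length ws = j - i + 1" using ij that by (simp add: ws_def)
    have "vs = take i vs @ ws @ drop (j - i + 1) (drop i vs)"
      by (simp only: ws_def append_take_drop_id)
    then have "successively E ws" using vs(2) by (metis successively_append_iff)
    moreover have "distinct ws" using vs(1) by (simp add: ws_def)
    moreover have "hd ws = vs ! i" using that ij by (simp add: ws_def hd_drop_conv_nth)
    moreover have "last ws = vs ! j"
    proof -
      have "last ws = ws ! (j - i)" using len last_conv_nth[of ws] by (cases "ws = []") auto
      then show ?thesis using ij that by (simp add: ws_def)
    qed
    moreover have "length ws \<ge> 3" using len ij by linarith
    ultimately show False using acyclic[of ws] that E_sym by auto
  qed
  assume E: "E (vs ! i) (vs ! j)"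
  then have "j \<le> Suc i" "i \<le> Suc j" using aux[of i j] aux[of j i] assms E_sym by auto
  moreover have "i \<noteq> j" using E E_irrefl by auto
  ultimately show "j = Suc i \<or> i = Suc j" by auto
next
  assume "j = Suc i \<or> i = Suc j"
  moreover have "E (vs ! i) (vs ! Suc i)" if "Suc i < length vs" for i
    using assms(1) that by (auto simp: hamiltonian_path_def successively_conv_nth)
  ultimately show "E (vs ! i) (vs ! j)" using assms E_sym by auto
qed

text \<open>An edge avoiding \<open>u\<close> would form a triangle with \<open>u\<close>.\<close>

lemma star_of_dominating:
  assumes "u \<in> V" "\<And>v. v \<in> V \<Longrightarrow> v \<noteq> u \<Longrightarrow> E u v"
  shows "E a b \<longleftrightarrow> a = u \<and> b \<in> V - {u} \<or> b = u \<and> a \<in> V - {u}"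
proof
  assume ab: "E a b"
  have in_V: "a \<in> V" "b \<in> V" and ne: "a \<noteq> b" using ab E_in E_sym E_irrefl by blast+
  have "a = u \<or> b = u"
  proof (rule ccontr)
    assume "\<not> ?thesis"
    then show False using triangle_free[of u a b] ab assms(2) in_V E_sym by blast
  qed
  then show "a = u \<and> b \<in> V - {u} \<or> b = u \<and> a \<in> V - {u}" using in_V ne by auto
next
  assume "a = u \<and> b \<in> V - {u} \<or> b = u \<and> a \<in> V - {u}"
  then show "E a b" using assms(2) E_sym by blast
qed

end

section \<open>From library trees to acyclic connected relations\<close>

lemma arcs_of_successively:
  assumes "successively (\<lambda>u v. (u, v) \<in> A) (x # xs)" "(last (x # xs), y) \<in> A"
  shows "set (zip (x # xs) (xs @ [y])) \<subseteq> A \<and> pcas x (zip (x # xs) (xs @ [y])) y \<and>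
    pawalk_verts x (zip (x # xs) (xs @ [y])) = x # xs @ [y]"
  using assms by (induction xs arbitrary: x) auto

lemma undirected_tree_acyclic_connected:
  assumes "undirected_tree T"
  shows "acyclic_connected (pverts T) (\<lambda>u v. (u, v) \<in> parcs T)"
proof -
  interpret pair_graph T using assms by (simp add: undirected_tree_def)
  have sym: "(v, u) \<in> parcs T" if "(u, v) \<in> parcs T" for u v
    using that pair_sym_arcs by (auto simp: symmetric_def sym_def)
  have conn: "strongly_connected (with_proj (mk_symmetric (with_proj T)))"
    using assms by (simp add: undirected_tree_def Digraph_Component.connected_def)
  \<comment> \<open>The library defines connectedness through the symmetric closure, which changes
    nothing here.\<close>
  have mk: "pverts (mk_symmetric (with_proj T)) = pverts T"
    "parcs (mk_symmetric (with_proj T)) = parcs T"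
    using sym by (auto simp: mk_symmetric_def)
  show ?thesis
  proof
    show "finite (pverts T)" by (rule pair_finite_verts)
    show "pverts T \<noteq> {}" using conn by (simp add: strongly_connected_def mk)
    show "u \<in> pverts T" if "(u, v) \<in> parcs T" for u v using in_arcsD1[OF that] .
    show "(v, u) \<in> parcs T" if "(u, v) \<in> parcs T" for u v using sym[OF that] .
    show "(u, u) \<notin> parcs T" for u using pair_no_loops by fastforce
  next
    fix vs :: "'a list"
    assume vs: "distinct vs" "3 \<le> length vs" "successively (\<lambda>u v. (u, v) \<in> parcs T) vs"
    show "(last vs, hd vs) \<notin> parcs T"
    proof
      assume close: "(last vs, hd vs) \<in> parcs T"
      obtain x xs where x: "vs = x # xs" using vs by (cases vs) auto
      \<comment> \<open>Pairing the vertex list with its cyclic shift gives the arcs of the closed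
        walk.\<close>
      let ?p = "zip (x # xs) (xs @ [x])"
      have p: "set ?p \<subseteq> parcs T" "pcas x ?p x" "pawalk_verts x ?p = x # xs @ [x]"
        using arcs_of_successively[of "parcs T" x xs x] vs close x by auto
      have "x \<in> pverts T" using in_arcsD2[OF close] x by simp
      then have "cycle ?p"
        unfolding cycle_def awalk_def using p vs x by (intro exI[of _ x]) auto
      moreover have "3 \<le> length ?p" using vs x by simp
      ultimately show False using assms by (auto simp: undirected_tree_def)
    qed
  next
    fix S assume S: "S \<subseteq> pverts T" "S \<noteq> {}" "S \<noteq> pverts T"
    show "\<exists>u\<in>S. \<exists>w\<in>pverts T - S. (u, w) \<in> parcs T"
    proof (rule ccontr)
      assume no: "\<not> ?thesis"
      obtain a b where ab: "a \<in> S" "b \<in> pverts T" "b \<notin> S" using S by blast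
      have "(a, b) \<in> rtrancl_on (pverts T) (parcs T)"
        using conn ab S unfolding strongly_connected_def reachable_def by (auto simp: mk)
      then have "b \<in> S"
        by (induction rule: rtrancl_on_induct) (use ab no in auto)
      then show False using ab by simp
    qed
  qed
qed

section \<open>Trees without a Hamiltonian path\<close>

context acyclic_connected
begin

lemma ex_neighbour:
  assumes "u \<in> V" "card V \<ge> 2"
  shows "\<exists>v. E u v"
proof -
  have "V \<noteq> {u}" using assms by auto
  then show ?thesis using connected[of "{u}"] assms by auto
qed

text \<open>Four vertices need separate treatment: the middle edge of the path on four vertices is
  remote, and the bound of \<open>path_graph_eigenvalue_ge\<close> fails for it. Here every tree
  other than the star is a path.\<close>

lemma hamiltonian_path_card_4:
  assumes card: "card V = 4" and dom: "\<And>u. u \<in> V \<Longrightarrow> \<exists>v\<in>V. v \<noteq> u \<and> \<not> E u v"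
  shows "\<exists>vs. hamiltonian_path E V vs"
proof -
  obtain u where u: "u \<in> V" using nonempty by blast
  obtain v where v: "E u v" using ex_neighbour[OF u] card by auto
  have vV: "v \<in> V" "u \<noteq> v" using v E_sym E_in E_irrefl by blast+
  have "V \<noteq> {u, v}" using card vV by auto
  then obtain s w where s: "s \<in> {u, v}" "w \<in> V" "w \<notin> {u, v}" "E s w"
    using connected[of "{u, v}"] u vV by blast
  obtain a b c where abc: "a \<in> V" "b \<in> V" "c \<in> V" "distinct [a, b, c]" "E a b" "E b c"
  proof (cases "s = u")
    case True
    then show thesis using that[of v u w] u vV s v E_sym by auto
  next
    case False
    then show thesis using that[of u v w] u vV s v by auto
  qed
  have "card (V - {a, b, c}) = 1"
    using card_Diff_subset[of "{a, b, c}" V] abc card by simp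
  then obtain d where d: "V - {a, b, c} = {d}" by (auto simp: card_1_singleton_iff)
  have V: "V = {a, b, c, d}" using d abc by auto
  have d': "d \<notin> {a, b, c}" using d by auto
  have "{a, b, c} \<noteq> V" using d by auto
  then obtain x where x: "x \<in> {a, b, c}" "E x d"
    using connected[of "{a, b, c}"] abc d by auto
  \<comment> \<open>If the fourth vertex hung on the middle vertex \<open>b\<close>, then
    \<open>b\<close> would be adjacent to all others.\<close>
  have "x \<noteq> b" using dom[of b] x(2) abc V E_sym by auto
  then consider "x = a" | "x = c" using x by auto
  then show ?thesis
  proof cases
    case 1
    then have "hamiltonian_path E V [d, a, b, c]"
      using V d' abc x E_sym by (auto simp: hamiltonian_path_def)
    then show ?thesis ..
  next
    case 2
    then have "hamiltonian_path E V [a, b, c, d]"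
      using V d' abc x by (auto simp: hamiltonian_path_def)
    then show ?thesis ..
  qed
qed

text \<open>The test vector for 2 cos theta I - A, with the signs of the bipartition, makes the
  quotient of the form of \<open>b\<close> strictly smaller than -4 cos theta. Entries of
  \<open>b\<close> above 2 only help.\<close>

lemma eigenvalue_less_if_no_hamiltonian_path:
  assumes no: "\<nexists>vs. hamiltonian_path E V vs"
    and b: "\<And>u v. u \<in> V \<Longrightarrow> v \<in> V \<Longrightarrow> b u v = b v u"
      "\<And>u v. E u v \<Longrightarrow> b u v \<ge> 2" "\<And>u v. u \<in> V \<Longrightarrow> v \<in> V \<Longrightarrow> \<not> E u v \<Longrightarrow> b u v = 0"
  shows "\<exists>k. eigenvalue_on V b k \<and> k < - 4 * cos (pi / real (card V + 1))"
proof -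
  \<comment> \<open>With this angle \<open>V\<close> has full length, and the bound on the test
    vector is 0.\<close>
  define \<theta> where "\<theta> = pi / real (card V + 1)"
  have pos: "\<theta> > 0" by (simp add: \<theta>_def)
  have full: "real (card V + 1) * \<theta> = pi" by (simp add: \<theta>_def)
  define c where "c u v = (if u = v then 2 * cos \<theta> else 0) - (if E u v then 1 else 0)" for u v
  obtain r where r: "r \<in> V" using nonempty by blast
  obtain \<epsilon> where tree: "rooted_tree E V r" and \<epsilon>: "\<And>u. \<epsilon> u = 1 \<or> \<epsilon> u = (-1::real)"
    "\<And>u v. E u v \<Longrightarrow> \<epsilon> u = - \<epsilon> v"
    by (rule coloured_spanning_tree[OF r]) blast
  have "\<exists>x. (\<forall>u. x u \<ge> 0) \<and> x r = 1 \<and> quad_form V c x \<le> sin_ratio \<theta> (card V) \<and>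
    (quad_form V c x < sin_ratio \<theta> (card V) \<or> (\<exists>vs. hamiltonian_path E V vs \<and>
      (real (card V + 1) * \<theta> < pi \<longrightarrow> hd vs = r)))"
    using full E_irrefl
    by (intro rooted_tree_test_vector[OF tree pos _ symp_E])
      (auto simp: c_def intro: E_sym)
  then obtain x where x: "\<And>u. x u \<ge> 0" "x r = 1" "quad_form V c x < sin_ratio \<theta> (card V)"
    using no by blast
  have "sin_ratio \<theta> (card V) = 0" using full by (simp add: sin_ratio_def)
  then have neg: "quad_form V c x < 0" using x by simp
  define N where "N = (\<Sum>u\<in>V. (x u)\<^sup>2)"
  have N: "N > 0"
  proof -
    have "(x r)\<^sup>2 \<le> N" unfolding N_def using r finite by (intro member_le_sum) auto
    then show ?thesis using x by simp
  qed
  obtain m where m: "eigenvalue_on V b m" "\<And>y. m * (\<Sum>u\<in>V. (y u)\<^sup>2) \<le> quad_form V b y"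
    using least_eigenvalue_minimizes_quad_form[of V b, OF finite nonempty b(1)] by blast
  \<comment> \<open>The signs turn an edge term into minus b u v x u x v, which is at most -2 x u x
    v as \<open>x\<close> is nonnegative.\<close>
  define y where "y u = \<epsilon> u * x u" for u
  have \<epsilon>2: "\<epsilon> u * \<epsilon> u = 1" for u using \<epsilon>(1)[of u] by auto
  have y2: "(\<Sum>u\<in>V. (y u)\<^sup>2) = N"
    unfolding N_def by (intro sum.cong) (auto simp: y_def power2_eq_square \<epsilon>2 algebra_simps)
  have A: "quad_form V c x = 2 * cos \<theta> * N - (\<Sum>u\<in>V. \<Sum>v\<in>V. if E u v then x u * x v else 0)"
  proof -
    have "quad_form V c x = (\<Sum>u\<in>V. \<Sum>v\<in>V. if u = v then 2 * cos \<theta> * (x u)\<^sup>2 else 0)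
        - (\<Sum>u\<in>V. \<Sum>v\<in>V. if E u v then x u * x v else 0)"
      unfolding quad_form_def sum_subtractf[symmetric]
      by (intro sum.cong refl) (auto simp: c_def power2_eq_square algebra_simps)
    then show ?thesis using finite by (simp add: N_def sum_distrib_left)
  qed
  have "quad_form V b y \<le> (\<Sum>u\<in>V. \<Sum>v\<in>V. - 2 * (if E u v then x u * x v else 0))"
    unfolding quad_form_def
  proof (intro sum_mono)
    fix u v assume uv: "u \<in> V" "v \<in> V"
    show "b u v * y u * y v \<le> - 2 * (if E u v then x u * x v else 0)"
    proof (cases "E u v")
      case True
      then have "\<epsilon> u * \<epsilon> v = -1" using \<epsilon>(2)[OF True] \<epsilon>2[of v] by simp
      moreover have "b u v * y u * y v = (\<epsilon> u * \<epsilon> v) * (b u v * (x u * x v))"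
        by (simp add: y_def ac_simps)
      moreover have "2 * (x u * x v) \<le> b u v * (x u * x v)"
        using b(2)[OF True] x by (intro mult_right_mono) auto
      ultimately show ?thesis using True by simp
    next
      case False
      then show ?thesis using b(3) uv by simp
    qed
  qed
  also have "\<dots> = - 2 * (\<Sum>u\<in>V. \<Sum>v\<in>V. if E u v then x u * x v else 0)"
    by (simp only: sum_distrib_left)
  also have "\<dots> < - 4 * cos \<theta> * N" using A neg by linarith
  finally have "m * N < - 4 * cos \<theta> * N" using m(2)[of y] y2 by simp
  then have "m < - 4 * cos \<theta>" using N by (simp only: mult_less_cancel_right_pos)
  then show ?thesis using m(1) unfolding \<theta>_def by blast
qed

end

section \<open>Paths\<close>

lemma path_graph_simps:
  "pverts (path_graph n) = {0..<n}"
  "(i, j) \<in> parcs (path_graph n) \<longleftrightarrow> i < n \<and> j < n \<and> (j = Suc i \<or> i = Suc j)"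
  by (auto simp: path_graph_def)

lemma path_graph_ecc_complement:
  assumes "n \<ge> 4" shows "ecc_complement (path_graph n)"
proof
  fix u assume u: "u \<in> pverts (path_graph n)"
  show "\<exists>v. (u, v) \<in> parcs (path_graph n)"
  proof (cases "u = 0")
    case True
    then show ?thesis using assms by (intro exI[of _ 1]) (simp add: path_graph_simps)
  next
    case False
    then show ?thesis using u by (intro exI[of _ "u - 1"]) (auto simp: path_graph_simps)
  qed
  show "\<exists>v\<in>pverts (path_graph n). v \<noteq> u \<and> (u, v) \<notin> parcs (path_graph n)"
  proof (cases "u \<ge> 2")
    case True
    then show ?thesis using u by (intro bexI[of _ 0]) (auto simp: path_graph_simps)
  next
    case False
    then show ?thesis using assms by (intro bexI[of _ 3]) (auto simp: path_graph_simps)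
  qed
qed (auto simp: path_graph_simps)

text \<open>An edge dominates 0 only if its smaller end is at most 1, and it dominates 4 only if
  that end is at least 2.\<close>

lemma path_graph_no_remote_edge:
  assumes "n \<ge> 5"
  shows "\<not> ecc_complement.remote_edge (path_graph n) i j"
proof
  interpret ecc_complement "path_graph n" using assms by (intro path_graph_ecc_complement) simp
  assume r: "remote_edge i j"
  then have ij: "i < n" "j < n" "j = Suc i \<or> i = Suc j"
    by (auto simp: remote_edge_def path_graph_simps)
  have all: "w = i \<or> w = j \<or> i = Suc w \<or> w = Suc i \<or> j = Suc w \<or> w = Suc j" if "w < n" for w
    using r that unfolding remote_edge_def path_graph_simps by auto
  show False using all[of 0] all[of 4] ij assms by auto
qed

text \<open>Without remote edges the matrix is twice the adjacency matrix, and the sine vector is a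
  positive eigenvector for 4 cos theta; it bounds all eigenvalues in modulus.\<close>

lemma path_graph_eigenvalue_ge:
  assumes n: "n \<ge> 5"
    and "eigenvalue_on {0..<n} (ecc_entry (complement_graph (path_graph n))) k"
  shows "k \<ge> - 4 * cos (pi / real (n + 1))"
proof -
  interpret ecc_complement "path_graph n" using n by (intro path_graph_ecc_complement) simp
  define \<theta> where "\<theta> = pi / real (n + 1)"
  have full: "real (n + 1) * \<theta> = pi" by (simp add: \<theta>_def)
  have pos: "\<theta> > 0" by (simp add: \<theta>_def)
  \<comment> \<open>Vertex \<open>i\<close> carries \<open>y (Suc i)\<close>. The values at indices
    0 and n + 1 vanish, so the recurrence holds at both ends of the path as well.\<close>
  define y where "y i = sin (real i * \<theta>)" for i :: nat
  have entry: "ecc_entry (complement_graph (path_graph n)) i j = (if j = Suc i \<or> i = Suc j then 2 else 0)"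
    if "i < n" "j < n" for i j
    using that ecc_entry_complement[of i j] path_graph_no_remote_edge[OF n, of i j]
    by (simp add: path_graph_simps)
  have step: "y (i + 2) + y i = 2 * cos \<theta> * y (i + 1)" for i
  proof -
    define a where "a = real (i + 1) * \<theta>"
    have "y (i + 2) = sin (a + \<theta>)" "y i = sin (a - \<theta>)" "y (i + 1) = sin a"
      by (simp_all add: y_def a_def algebra_simps)
    then show ?thesis by (simp add: sin_add sin_diff)
  qed
  have row: "(\<Sum>j\<in>{0..<n}. ecc_entry (complement_graph (path_graph n)) i j * y (Suc j))
      = 4 * cos \<theta> * y (Suc i)" if i: "i < n" for i
  proof -
    have "(\<Sum>j\<in>{0..<n}. ecc_entry (complement_graph (path_graph n)) i j * y (Suc j)) =
      (\<Sum>j\<in>{0..<n}. (if j = Suc i then 2 * y (i + 2) else 0) + (if Suc j = i then 2 * y i else 0))"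
      using i by (intro sum.cong) (auto simp: entry)
    also have "\<dots> = (if Suc i < n then 2 * y (i + 2) else 0) + (\<Sum>j\<in>{0..<n}. if Suc j = i then 2 * y i else 0)"
      by (simp add: sum.distrib)
    also have "(\<Sum>j\<in>{0..<n}. if Suc j = i then 2 * y i else 0) = 2 * y i"
    proof (cases i)
      case 0
      then show ?thesis by (simp add: y_def)
    next
      case (Suc l)
      then show ?thesis using i by simp
    qed
    also have "(if Suc i < n then 2 * y (i + 2) else 0) = 2 * y (i + 2)"
    proof (cases "Suc i < n")
      case False
      then have "i + 2 = n + 1" using i by simp
      then have "y (i + 2) = 0" unfolding y_def using full by simp
      then show ?thesis by simp
    qed simp
    finally show ?thesis using step[of i] by simp
  qed
  have "\<bar>k\<bar> \<le> 4 * cos \<theta>"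
  proof (rule eigenvalue_on_bounded_by_positive_supersolution[OF _ _ _ _ assms(2)])
    show "y (Suc i) > 0" if "i \<in> {0..<n}" for i
    proof -
      have "real (Suc i) * \<theta> < real (n + 1) * \<theta>"
        using that pos by (intro mult_strict_right_mono) auto
      then show ?thesis unfolding y_def using full sin_multiple_pos[OF pos, of "Suc i"] by simp
    qed
  next
    show "(\<Sum>j\<in>{0..<n}. ecc_entry (complement_graph (path_graph n)) i j * y (Suc j))
      \<le> 4 * cos \<theta> * y (Suc i)" if "i \<in> {0..<n}" for i
      using row[of i] that by simp
  qed (auto simp: entry)
  then show ?thesis unfolding \<theta>_def by linarith
qed

section \<open>Isomorphism with the path\<close>

lemma (in ecc_complement) ecc_entry_complement_sym:
  assumes "u \<in> pverts G" "v \<in> pverts G"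
  shows "ecc_entry (complement_graph G) u v = ecc_entry (complement_graph G) v u"
  using ecc_entry_complement[OF assms] ecc_entry_complement[OF assms(2,1)]
    arc_sym_iff[of u v] remote_edge_sym[of u v] by simp

lemma (in ecc_complement) spectrum_complement:
  "spectrum (ecc_matrix (complement_graph G)) =
    {k. eigenvalue_on (pverts G) (ecc_entry (complement_graph G)) k}"
  using spectrum_ecc_matrix[of "complement_graph G"] finite_verts by (simp add: complement_verts)

text \<open>By \<open>ecc_entry_complement\<close> an entry depends only on adjacency and
  domination, which isomorphisms preserve.\<close>

lemma ecc_entry_complement_transfer:
  assumes "ecc_complement G" "ecc_complement H" and bij: "bij_betw \<phi> (pverts G) (pverts H)"
    and arcs: "\<And>u v. u \<in> pverts G \<Longrightarrow> v \<in> pverts G \<Longrightarrow>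
      (\<phi> u, \<phi> v) \<in> parcs H \<longleftrightarrow> (u, v) \<in> parcs G"
    and uv: "u \<in> pverts G" "v \<in> pverts G"
  shows "ecc_entry (complement_graph H) (\<phi> u) (\<phi> v) = ecc_entry (complement_graph G) u v"
proof -
  interpret G: ecc_complement G by fact
  interpret H: ecc_complement H by fact
  have H: "pverts H = \<phi> ` pverts G" and inj: "inj_on \<phi> (pverts G)" using bij by (auto simp: bij_betw_def)
  have "H.remote_edge (\<phi> u) (\<phi> v) \<longleftrightarrow> G.remote_edge u v"
    unfolding H.remote_edge_def G.remote_edge_def H
    using arcs uv inj by (auto simp: inj_on_eq_iff[OF inj])
  moreover have "\<phi> u \<in> pverts H" "\<phi> v \<in> pverts H" using uv H by auto
  ultimately show ?thesis
    using G.ecc_entry_complement[OF uv] H.ecc_entry_complement arcs[OF uv] by simp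
qed

lemma digraph_iso_path_graphI:
  assumes "pair_wf_digraph T" "hamiltonian_path (\<lambda>u v. (u, v) \<in> parcs T) (pverts T) vs"
    and iff: "\<And>i j. i < length vs \<Longrightarrow> j < length vs \<Longrightarrow>
      (vs ! i, vs ! j) \<in> parcs T \<longleftrightarrow> j = Suc i \<or> i = Suc j"
  shows "digraph_iso (with_proj T) (with_proj (path_graph (length vs)))"
proof -
  interpret pair_wf_digraph T by fact
  have vs: "distinct vs" "set vs = pverts T" using assms(2) by (auto simp: hamiltonian_path_def)
  have bij: "bij_betw (nth vs) {0..<length vs} (pverts T)"
    using bij_betw_nth[OF vs(1), of "{0..<length vs}" "pverts T"] vs(2) by (simp add: lessThan_atLeast0)
  define \<phi> where "\<phi> = the_inv_into {0..<length vs} (nth vs)"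
  have \<phi>: "bij_betw \<phi> (pverts T) {0..<length vs}"
    unfolding \<phi>_def by (rule bij_betw_the_inv_into[OF bij])
  have \<phi>_nth: "\<phi> (vs ! i) = i" if "i < length vs" for i
    unfolding \<phi>_def using bij that by (intro the_inv_into_f_f) (auto simp: bij_betw_def)
  have nth_\<phi>: "vs ! \<phi> u = u" "\<phi> u < length vs" if "u \<in> pverts T" for u
  proof -
    obtain i where "i < length vs" "u = vs ! i" using \<open>u \<in> pverts T\<close> vs(2) by (metis in_set_conv_nth)
    then show "vs ! \<phi> u = u" "\<phi> u < length vs" using \<phi>_nth by auto
  qed
  have inj: "inj_on \<phi> (pverts T)" using \<phi> by (auto simp: bij_betw_def)
  \<comment> \<open>Vertices go to their positions in \<open>vs\<close>. A library isomorphism also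
    prescribes the new end maps, which must be the projections of pairs.\<close>
  define f where "f = \<lparr> iso_verts = \<phi>, iso_arcs = map_prod \<phi> \<phi>, iso_head = snd, iso_tail = fst \<rparr>"
  have parcs_sub: "parcs T \<subseteq> pverts T \<times> pverts T" using in_arcsD1 in_arcsD2 by auto
  have arcs: "map_prod \<phi> \<phi> ` parcs T = parcs (path_graph (length vs))" (is "?L = ?R")
  proof (intro equalityI subrelI)
    fix i j assume "(i, j) \<in> ?L"
    then obtain u v where uv: "(u, v) \<in> parcs T" "i = \<phi> u" "j = \<phi> v" by auto
    then show "(i, j) \<in> ?R"
      using iff[of i j] nth_\<phi>[of u] nth_\<phi>[of v] in_arcsD1[OF uv(1)] in_arcsD2[OF uv(1)]
      by (simp add: path_graph_simps)
  next
    fix i j assume "(i, j) \<in> ?R"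
    then have "(vs ! i, vs ! j) \<in> parcs T" "i < length vs" "j < length vs"
      using iff[of i j] by (auto simp: path_graph_simps)
    then show "(i, j) \<in> ?L" using \<phi>_nth by (metis image_eqI map_prod_simp)
  qed
  have "digraph_isomorphism f"
    unfolding digraph_isomorphism_def f_def
    using inj inj_on_subset[OF map_prod_inj_on[OF inj inj] parcs_sub] wf_digraph_axioms
    by auto
  moreover have "with_proj (path_graph (length vs)) = app_iso f (with_proj T)"
    unfolding app_iso_def f_def with_proj_def
    using \<phi> arcs by (simp add: path_graph_simps bij_betw_def)
  ultimately show ?thesis unfolding digraph_iso_def by blast
qed

lemma hamiltonian_path_if_digraph_iso_path_graph:
  assumes "digraph_iso (with_proj T) (with_proj (path_graph n))" "n \<ge> 1"
  shows "\<exists>vs. hamiltonian_path (\<lambda>u v. (u, v) \<in> parcs T) (pverts T) vs"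
proof -
  obtain f where f: "pre_digraph.digraph_isomorphism (with_proj T) f"
    "with_proj (path_graph n) = app_iso f (with_proj T)"
    using assms(1) unfolding digraph_iso_def by blast
  \<comment> \<open>Comparing the records forces the projections as end maps, so arcs are mapped as
    the pairs of their ends.\<close>
  have verts: "iso_verts f ` pverts T = {0..<n}" and arcs: "iso_arcs f ` parcs T = parcs (path_graph n)"
    and ends: "iso_tail f = fst" "iso_head f = snd"
    using f(2) unfolding app_iso_def with_proj_def by (auto simp: path_graph_simps)
  have inj: "inj_on (iso_verts f) (pverts T)" and wf: "wf_digraph (with_proj T)"
    and arc: "\<And>a. a \<in> parcs T \<Longrightarrow> iso_verts f (fst a) = fst (iso_arcs f a) \<and>
      iso_verts f (snd a) = snd (iso_arcs f a)"
    using f(1) ends unfolding pre_digraph.digraph_isomorphism_def by auto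
  interpret pair_wf_digraph T using wf wf_digraph_wp_iff by blast
  define \<psi> where "\<psi> = the_inv_into (pverts T) (iso_verts f)"
  have \<psi>: "bij_betw \<psi> {0..<n} (pverts T)"
    unfolding \<psi>_def using inj verts by (intro bij_betw_the_inv_into) (auto simp: bij_betw_def)
  have "(\<psi> i, \<psi> (Suc i)) \<in> parcs T" if "Suc i < n" for i
  proof -
    have "(i, Suc i) \<in> parcs (path_graph n)" using that by (simp add: path_graph_simps)
    then obtain u v where uv: "(u, v) \<in> parcs T" "iso_arcs f (u, v) = (i, Suc i)"
      unfolding arcs[symmetric] by auto
    then have "iso_verts f u = i" "iso_verts f v = Suc i" using arc[OF uv(1)] by auto
    then have "\<psi> i = u" "\<psi> (Suc i) = v"
      unfolding \<psi>_def
      using the_inv_into_f_f[OF inj in_arcsD1[OF uv(1)]] the_inv_into_f_f[OF inj in_arcsD2[OF uv(1)]]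
      by simp_all
    then show ?thesis using uv by simp
  qed
  then have "hamiltonian_path (\<lambda>u v. (u, v) \<in> parcs T) (pverts T) (map \<psi> [0..<n])"
    using \<psi> assms(2) unfolding hamiltonian_path_def
    by (auto simp: successively_conv_nth distinct_map bij_betw_def)
  then show ?thesis ..
qed

section \<open>Comparison of a tree with the path\<close>

theorem theorem3p8:
  fixes T :: "'a pair_pre_digraph" and n :: nat
  assumes "undirected_tree T"
    and "card (pverts T) = n"
    and "n \<ge> 4"
    and "\<not> complete_bipartite_digraph 1 (n - 1) (with_proj T)"
  shows "least_ecc_eigenvalue (complement_graph T)
           \<le> least_ecc_eigenvalue (complement_graph (path_graph n)) \<and>
         (least_ecc_eigenvalue (complement_graph T)
           = least_ecc_eigenvalue (complement_graph (path_graph n))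
         \<longleftrightarrow> digraph_iso (with_proj T) (with_proj (path_graph n)))"
proof -
  let ?E = "\<lambda>u v. (u, v) \<in> parcs T"
  interpret T: acyclic_connected "pverts T" ?E
    by (rule undirected_tree_acyclic_connected[OF assms(1)])
  have wf: "pair_wf_digraph T"
    using T.E_in T.E_in[OF T.E_sym] by unfold_locales auto
  \<comment> \<open>A vertex adjacent to all others would be the centre of the excluded
    star.\<close>
  have dom: "\<exists>v\<in>pverts T. v \<noteq> u \<and> \<not> ?E u v" if u: "u \<in> pverts T" for u
  proof (rule ccontr)
    assume "\<not> ?thesis"
    then have star: "parcs T = {u} \<times> (pverts T - {u}) \<union> (pverts T - {u}) \<times> {u}"
      using T.star_of_dominating[OF u] by auto
    have "pverts T = {u} \<union> (pverts T - {u})" "{u} \<inter> (pverts T - {u}) = {}" using u by auto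
    moreover have "card {u} = 1" "card (pverts T - {u}) = n - 1"
      using u assms(2) T.finite by auto
    ultimately have "complete_bipartite_digraph 1 (n - 1) (with_proj T)"
      unfolding complete_bipartite_digraph_pair_def using T.finite star by blast
    then show False using assms(4) by simp
  qed
  have T: "ecc_complement T"
  proof
    show "\<exists>v. ?E u v" if "u \<in> pverts T" for u using T.ex_neighbour[OF that] assms by simp
  qed (use T.finite T.E_in T.E_sym T.E_irrefl T.triangle_free T.four_cycle_free dom in blast)+
  interpret C: ecc_complement T by (rule T)
  have P: "ecc_complement (path_graph n)" using assms by (intro path_graph_ecc_complement)
  interpret P: ecc_complement "path_graph n" by (rule P)
  let ?bT = "ecc_entry (complement_graph T)" and ?bP = "ecc_entry (complement_graph (path_graph n))"
  \<comment> \<open>With a Hamiltonian path the tree is isomorphic to the path and the spectra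
    agree. Without one, -4 cos (pi / (n + 1)) separates the two least eigenvalues strictly.\<close>
  show ?thesis
  proof (cases "\<exists>vs. hamiltonian_path ?E (pverts T) vs")
    case True
    then obtain vs where vs: "hamiltonian_path ?E (pverts T) vs" ..
    then have len: "length vs = n" and bij: "bij_betw (nth vs) {0..<n} (pverts T)"
      using assms(2) distinct_card[of vs] bij_betw_nth[of vs "{0..<n}" "pverts T"]
      by (auto simp: hamiltonian_path_def lessThan_atLeast0)
    note adj = T.hamiltonian_path_adjacent_iff[OF vs]
    have "digraph_iso (with_proj T) (with_proj (path_graph n))"
      using digraph_iso_path_graphI[OF wf vs adj] len by simp
    moreover have "spectrum (ecc_matrix (complement_graph (path_graph n))) =
        spectrum (ecc_matrix (complement_graph T))"
    proof -
      have "?bT (vs ! i) (vs ! j) = ?bP i j" if "i \<in> {0..<n}" "j \<in> {0..<n}" for i j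
        using that by (intro ecc_entry_complement_transfer[OF P T])
          (auto simp: path_graph_simps bij adj len)
      then show ?thesis
        unfolding C.spectrum_complement P.spectrum_complement path_graph_simps(1)
        using eigenvalue_on_bij[OF bij, of ?bT ?bP] by (intro Collect_cong) blast
    qed
    ultimately show ?thesis by (simp add: least_ecc_eigenvalue_def)
  next
    case False
    then have n5: "n \<ge> 5" using T.hamiltonian_path_card_4 dom assms(2,3) by fastforce
    have "?bT u v \<ge> 2" if "?E u v" for u v
      using C.ecc_entry_complement[of u v] T.E_in that T.E_sym[OF that] by simp
    then have "\<exists>k. eigenvalue_on (pverts T) ?bT k \<and> k < - 4 * cos (pi / real (card (pverts T) + 1))"
      using False C.ecc_entry_complement_sym C.ecc_entry_complement
      by (intro T.eigenvalue_less_if_no_hamiltonian_path) auto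
    then obtain k where k: "eigenvalue_on (pverts T) ?bT k" "k < - 4 * cos (pi / real (n + 1))"
      using assms(2) by auto
    have "k \<in> spectrum (ecc_matrix (complement_graph T))"
      using k by (simp add: C.spectrum_complement)
    then have "least_ecc_eigenvalue (complement_graph T) \<le> k"
      unfolding least_ecc_eigenvalue_def by (intro Min_le finite_spectrum_ecc_matrix)
    moreover have "least_ecc_eigenvalue (complement_graph (path_graph n)) \<ge> - 4 * cos (pi / real (n + 1))"
    proof -
      \<comment> \<open>An eigenvalue has to be exhibited because \<open>Min\<close> of an empty
        spectrum would be unspecified.\<close>
      obtain m where "eigenvalue_on {0..<n} ?bP m"
        using least_eigenvalue_minimizes_quad_form[of "{0..<n}" ?bP] P.ecc_entry_complement_sym assms(3)
        by (auto simp: path_graph_simps)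
      then have "spectrum (ecc_matrix (complement_graph (path_graph n))) \<noteq> {}"
        by (auto simp: P.spectrum_complement path_graph_simps)
      moreover have "- 4 * cos (pi / real (n + 1)) \<le> l"
        if "l \<in> spectrum (ecc_matrix (complement_graph (path_graph n)))" for l
        using that path_graph_eigenvalue_ge[OF n5] unfolding P.spectrum_complement path_graph_simps
        by simp
      ultimately show ?thesis
        unfolding least_ecc_eigenvalue_def by (intro Min.boundedI finite_spectrum_ecc_matrix)
    qed
    moreover have "\<not> digraph_iso (with_proj T) (with_proj (path_graph n))"
      using False hamiltonian_path_if_digraph_iso_path_graph assms(3) by fastforce
    ultimately show ?thesis using k by auto
  qed
qed

end
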